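(* For each $k \in \{3,4,5\}$, there exists a randomized algorithm in the CONGEST model that detects $2k$-cycles (i.e., decides whether the $n$-node input graph $G$ contains a cycle of length $2k$) in $O(n^{1-1/k})$ rounds.
   Context: CONGEST model: the input graph $G$ with $n$ nodes is also the communication network; computation proceeds in synchronous rounds, and in each round each node may send a message of $O(\log n)$ bits to each of its neighbors in $G$. Initially each node knows its incident edges. Detection: if $G$ contains no cycle of length $2k$ all nodes accept, and otherwise (with the algorithm's success probability) some node rejects. *)

theory Defs
  imports
    "HOL-Probability.Product_PMF"
    "HOL-Library.Landau_Symbols"
    "Graph_Theory.Pair_Digraph"
begin

text \<open>
  A simple undirected graph is a \<^locale>\<open>pair_graph\<close>: finite, loop-free, and with every edge
  represented by both of its orientations. The vertices are the nodes' unique identifiers.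

  Local computation in CONGEST is unbounded, so the state of a node can be taken to be everything
  it has learned so far: the number of nodes, its incident edges (own identifier and the
  identifiers of its neighbours), its private random bits, and the messages received in each round,
  oldest round first. A message is a bit string, and the empty string stands for silence.
\<close>

type_synonym bits = "bool list"

record local_view =
  net_size :: nat
  own_id :: nat
  nbr_ids :: "nat set"
  coins :: bits
  received :: "(nat \<Rightarrow> bits) list"

text \<open>
  The message sent in the next round may differ from recipient to recipient (the second argument
  of \<open>send\<close>). The current round number is the length of \<^const>\<open>received\<close>.
\<close>

record algorithm =
  rounds :: "nat \<Rightarrow> nat"
  bandwidth :: "nat \<Rightarrow> nat"
  num_coins :: "nat \<Rightarrow> nat"
  send :: "local_view \<Rightarrow> nat \<Rightarrow> bits"
  accept :: "local_view \<Rightarrow> bool"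

definition congest :: "algorithm \<Rightarrow> bool" where
  "congest A \<longleftrightarrow>
     (\<forall>w u. length (send A w u) \<le> bandwidth A (net_size w)) \<and>
     (\<lambda>n. real (bandwidth A n)) \<in> O(\<lambda>n. ln (real n))"

text \<open>Identifiers consist of \<open>O(log n)\<close> bits, i.e. they are bounded by a polynomial \<open>n ^ c\<close>.\<close>

definition network :: "nat \<Rightarrow> nat pair_pre_digraph \<Rightarrow> bool" where
  "network c G \<longleftrightarrow> pair_graph G \<and> pverts G \<subseteq> {..<card (pverts G) ^ c}"

definition nbrs :: "nat pair_pre_digraph \<Rightarrow> nat \<Rightarrow> nat set" where
  "nbrs G v = {u. (v, u) \<in> parcs G}"

definition view_of ::
  "nat pair_pre_digraph \<Rightarrow> (nat \<Rightarrow> bits) \<Rightarrow> nat \<Rightarrow> (nat \<Rightarrow> bits) list \<Rightarrow> local_view" where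
  "view_of G r v h =
     \<lparr>net_size = card (pverts G), own_id = v, nbr_ids = nbrs G v, coins = r v, received = h\<rparr>"

primrec view_after ::
  "algorithm \<Rightarrow> nat pair_pre_digraph \<Rightarrow> (nat \<Rightarrow> bits) \<Rightarrow> nat \<Rightarrow> nat \<Rightarrow> local_view" where
  "view_after A G r 0 v = view_of G r v []"
| "view_after A G r (Suc t) v =
     view_of G r v (received (view_after A G r t v) @
       [\<lambda>u. if u \<in> nbrs G v then send A (view_after A G r t u) v else []])"

definition accepts ::
  "algorithm \<Rightarrow> nat pair_pre_digraph \<Rightarrow> (nat \<Rightarrow> bits) \<Rightarrow> nat \<Rightarrow> bool" where
  "accepts A G r v \<longleftrightarrow> accept A (view_after A G r (rounds A (card (pverts G))) v)"

text \<open>Every node independently receives a uniformly random bit string.\<close>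

definition coin_pmf :: "algorithm \<Rightarrow> nat pair_pre_digraph \<Rightarrow> (nat \<Rightarrow> bits) pmf" where
  "coin_pmf A G =
     Pi_pmf (pverts G) [] (\<lambda>_. pmf_of_set {bs. length bs = num_coins A (card (pverts G))})"

definition has_cycle :: "nat pair_pre_digraph \<Rightarrow> nat \<Rightarrow> bool" where
  "has_cycle G l \<longleftrightarrow> (\<exists>p. pre_digraph.cycle (with_proj G) p \<and> length p = l)"

text \<open>
  The error is one-sided: without a cycle of length \<open>l\<close>, all nodes accept under every outcome
  of the coins; \<open>q\<close> is the success probability otherwise.
\<close>

definition detects_cycle :: "nat \<Rightarrow> real \<Rightarrow> nat \<Rightarrow> algorithm \<Rightarrow> bool" where
  "detects_cycle c q l A \<longleftrightarrow>
     (\<forall>G. network c G \<longrightarrow>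
        (\<not> has_cycle G l \<longrightarrow>
           (\<forall>r \<in> set_pmf (coin_pmf A G). \<forall>v \<in> pverts G. accepts A G r v)) \<and>
        (has_cycle G l \<longrightarrow>
           measure_pmf.prob (coin_pmf A G) {r. \<exists>v \<in> pverts G. \<not> accepts A G r v} \<ge> q))"

end

theory Submission
  imports Defs
begin

text \<open>
  Colour coding with a global congestion threshold \<open>T = O(n^(1-1/k))\<close>. Colour
  the nodes at random; a \<open>2k\<close>-cycle is correctly coloured with constant
  probability. Identifiers of source nodes of colour \<open>0\<close> travel along two
  disjoint colour sequences to the node opposite on the cycle, which rejects when the same
  identifier arrives on both sides. A node holding more than \<open>T\<close> identifiers
  stays silent.

  If all degrees on the cycle are \<open>O(n^(1/k))\<close>, search among such nodes only: a
  node at level \<open>i < k\<close> sees \<open>O(n^(i/k))\<close> sources. Otherwise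
  sample each node into \<open>S\<close> with probability about \<open>n^(-1/k)\<close>:
  with constant probability \<open>|S| = O(n^(1-1/k))\<close> and some node of the cycle has
  \<open>k^2\<close> neighbours in \<open>S\<close>. A search from \<open>S\<close> finds a
  \<open>2k\<close>-cycle that meets \<open>S\<close>, if there is one. If there is none,
  search outside \<open>S\<close> from all nodes with \<open>k^2\<close> neighbours in
  \<open>S\<close>: a node reached by more than \<open>k^2 |S|\<close> such sources would
  yield a dense bipartite graph between \<open>S\<close> and these sources, and an
  alternating path in it closes up to a \<open>2k\<close>-cycle through \<open>S\<close>. So
  there is no congestion.
\<close>

section \<open>Congestion forces a cycle through the sample\<close>

text \<open>The threshold matters in one direction only: two routes of one identifier along
  different colours always close up to a cycle, so every bound on congestion serves completeness
  alone. The obstacle is that heavy sources can be too many for a direct count. The third search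
  rests on a dichotomy: too many of them at one node create a \<open>2k\<close>-cycle through
  \<open>S\<close>, and then the second search has something to find. Hence the cycle that is found
  need not be the one given, and it depends on the sample. Sample and colours therefore use separate
  coins, so that the cycle to be coloured may be chosen after the sample is fixed.

  The requirement of \<open>k^2\<close> neighbours in \<open>S\<close> is the budget of an induction
  over layers: an origin loses at most \<open>k\<close> edges per layer and at most
  \<open>k - 1\<close> layers are passed, so at least \<open>k\<close> edges survive, while at layer
  \<open>i\<close> a node of \<open>S\<close> retains at most \<open>1 + i * k <= k^2\<close> of
  them.\<close>

definition closed_path :: "('a \<Rightarrow> 'a \<Rightarrow> bool) \<Rightarrow> 'a list \<Rightarrow> bool" where
  "closed_path E xs \<longleftrightarrow> xs \<noteq> [] \<and> distinct xs \<and> successively E xs \<and> E (last xs) (hd xs)"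

text \<open>Only walks are required. The layers will be colour classes, and their disjointness turns
  such walks into paths.\<close>

definition layer_origins :: "('a \<Rightarrow> 'a \<Rightarrow> bool) \<Rightarrow> (nat \<Rightarrow> 'a set) \<Rightarrow> nat \<Rightarrow> 'a \<Rightarrow> 'a set" where
  "layer_origins E V i v =
     {w. \<exists>p. p 0 = w \<and> p i = v \<and> (\<forall>j\<le>i. p j \<in> V j) \<and> (\<forall>j<i. E (p j) (p (Suc j)))}"

lemma layer_origins_0: "layer_origins E V 0 v = V 0 \<inter> {v}"
  by (auto simp: layer_origins_def)

lemma layer_origins_Suc:
  "layer_origins E V (Suc i) v =
     (if v \<in> V (Suc i) then \<Union>u\<in>{u. E u v}. layer_origins E V i u else {})"
proof (intro subset_antisym subsetI)
  fix w assume "w \<in> layer_origins E V (Suc i) v"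
  then obtain p where p: "p 0 = w" "p (Suc i) = v" "\<forall>j\<le>Suc i. p j \<in> V j"
    "\<forall>j<Suc i. E (p j) (p (Suc j))"
    by (auto simp: layer_origins_def)
  then have "w \<in> layer_origins E V i (p i)" "E (p i) v"
    by (auto simp: layer_origins_def intro!: exI[of _ p])
  then show "w \<in> (if v \<in> V (Suc i) then \<Union>u\<in>{u. E u v}. layer_origins E V i u else {})"
    using p by auto
next
  fix w assume w: "w \<in> (if v \<in> V (Suc i) then \<Union>u\<in>{u. E u v}. layer_origins E V i u else {})"
  then have v: "v \<in> V (Suc i)" by (auto split: if_splits)
  with w obtain u p where u: "E u v" and p: "p 0 = w" "p i = u" "\<forall>j\<le>i. p j \<in> V j"
    "\<forall>j<i. E (p j) (p (Suc j))"
    by (auto simp: layer_origins_def)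
  show "w \<in> layer_origins E V (Suc i) v"
    unfolding layer_origins_def
    by (rule CollectI, rule exI[of _ "p(Suc i := v)"])
      (use u v p in \<open>auto simp: less_Suc_eq le_Suc_eq\<close>)
qed

lemma layer_origins_subset: "layer_origins E V i v \<subseteq> V 0"
  by (auto simp: layer_origins_def)

text \<open>
  Choosing the next node as a function of the current node alone makes paths that meet stay
  together, so paths with different last-but-one nodes are disjoint up to their common end.
\<close>

lemma merging_paths:
  obtains P where
    "\<And>w. w \<in> layer_origins E V i v \<Longrightarrow> P w 0 = w \<and> P w i = v \<and> (\<forall>j\<le>i. P w j \<in> V j) \<and>
       (\<forall>j<i. E (P w j) (P w (Suc j)))"
    "\<And>w w' j l. P w j = P w' j \<Longrightarrow> j \<le> l \<Longrightarrow> P w l = P w' l"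
proof -
  \<comment> \<open>\<open>alive j x\<close> says that \<open>v\<close> can still be reached from
    \<open>x\<close> at level \<open>j\<close>. Restricting \<open>nxt\<close> to alive successors
    keeps a choice that does not see the origin from running into a dead end.\<close>
  define alive where "alive = (\<lambda>j x. \<exists>p. p j = x \<and> p i = v \<and>
    (\<forall>l. j \<le> l \<and> l \<le> i \<longrightarrow> p l \<in> V l) \<and> (\<forall>l. j \<le> l \<and> l < i \<longrightarrow> E (p l) (p (Suc l))))"
  define nxt where "nxt = (\<lambda>j x. SOME y. E x y \<and> alive (Suc j) y)"
  define P where "P = (\<lambda>w. rec_nat w nxt)"
  have P0: "P w 0 = w" and PS: "P w (Suc j) = nxt j (P w j)" for w j
    by (simp_all add: P_def)
  have nxt: "E x (nxt j x) \<and> alive (Suc j) (nxt j x)" if "alive j x" "j < i" for j x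
  proof -
    from that obtain p where "p j = x" "p i = v" "\<forall>l. j \<le> l \<and> l \<le> i \<longrightarrow> p l \<in> V l"
      "\<forall>l. j \<le> l \<and> l < i \<longrightarrow> E (p l) (p (Suc l))"
      unfolding alive_def by blast
    with that have "E x (p (Suc j)) \<and> alive (Suc j) (p (Suc j))"
      unfolding alive_def by (intro conjI exI[of _ p]) auto
    then show ?thesis unfolding nxt_def by (rule someI)
  qed
  have al: "alive j (P w j)" if "w \<in> layer_origins E V i v" "j \<le> i" for w j
    using that(2)
  proof (induction j)
    case 0
    from that show ?case by (auto simp: layer_origins_def alive_def P0)
  next
    case (Suc j)
    then show ?case using nxt[of j "P w j"] by (simp add: PS)
  qed
  show ?thesis
  proof (rule that[of P])
    fix w assume w: "w \<in> layer_origins E V i v"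
    have "P w j \<in> V j" if "j \<le> i" for j
      using al[OF w that] that by (auto simp: alive_def)
    moreover have "E (P w j) (P w (Suc j))" if "j < i" for j
      using nxt[of j "P w j"] al[OF w, of j] that by (simp add: PS)
    moreover have "P w i = v" using al[OF w, of i] by (auto simp: alive_def)
    ultimately show "P w 0 = w \<and> P w i = v \<and> (\<forall>j\<le>i. P w j \<in> V j) \<and>
       (\<forall>j<i. E (P w j) (P w (Suc j)))" by (simp add: P0)
  next
    fix w w' j l assume "P w j = P w' j" "j \<le> l"
    from this(2,1) show "P w l = P w' l"
      by (induction rule: dec_induct) (simp_all add: PS)
  qed
qed

text \<open>
  Edges are peeled off at vertices of small degree. Those at a vertex on the left are kept
  in \<open>R\<close>, those at a vertex on the right are discarded, which costs that vertex
  at most \<open>d\<close> edges since it happens once.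
\<close>

lemma bipartite_peeling:
  fixes X :: "('s \<times> 'w) set"
  assumes "finite X"
  shows "(\<exists>F\<subseteq>X. F \<noteq> {} \<and> (\<forall>(s, w)\<in>F. c < card {w'. (s, w') \<in> F} \<and> d < card {s'. (s', w) \<in> F})) \<or>
    (\<exists>R\<subseteq>X. (\<forall>s. card {w. (s, w) \<in> R} \<le> c) \<and>
       (\<forall>w. card {s. (s, w) \<in> X} \<le> card {s. (s, w) \<in> R} + d))"
  (is "?dense X \<or> ?sparse X")
  using assms
proof (induction "card X" arbitrary: X rule: less_induct)
  case less
  have fins: "finite {s. (s, w) \<in> Y}" if "finite Y" for w and Y :: "('s \<times> 'w) set"
    by (rule finite_subset[OF _ finite_imageI[OF that, of fst]]) force
  have mono: "?dense Y \<Longrightarrow> ?dense X" if "Y \<subseteq> X" for Y using that by blast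
  consider "X = {}" 
    | "X \<noteq> {}" "\<And>s w. (s, w) \<in> X \<Longrightarrow> c < card {w'. (s, w') \<in> X} \<and> d < card {s'. (s', w) \<in> X}"
    | s w where "(s, w) \<in> X" "card {w'. (s, w') \<in> X} \<le> c"
    | s w where "(s, w) \<in> X" "card {s'. (s', w) \<in> X} \<le> d"
    using not_le by blast
  then show ?case
  proof cases
    case 1
    then show ?thesis by (intro disjI2 exI[of _ "{}"]) auto
  next
    case 2
    then show ?thesis by (intro disjI1 exI[of _ X]) auto
  next
    case (3 s w)
    define Y where "Y = {(s', w'). (s', w') \<in> X \<and> s' \<noteq> s}"
    have Y: "Y \<subset> X" using 3 by (auto simp: Y_def)
    then have "finite Y" using less.prems finite_subset by blast
    with Y less have "?dense Y \<or> ?sparse Y" by (simp add: psubset_card_mono)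
    then show ?thesis
    proof
      assume "?dense Y" with mono Y show ?thesis by blast
    next
      assume "?sparse Y"
      then obtain R where R: "R \<subseteq> Y" "\<And>s. card {w. (s, w) \<in> R} \<le> c"
        "\<And>w. card {s. (s, w) \<in> Y} \<le> card {s. (s, w) \<in> R} + d" by blast
      \<comment> \<open>All edges still present at \<open>s\<close> are kept: there are at most
        \<open>c\<close> of them, and \<open>R\<close> has none at \<open>s\<close>, so the bound at
        \<open>s\<close> holds. Nodes on the right lose nothing here.\<close>
      let ?R = "R \<union> {(s', w'). (s', w') \<in> X \<and> s' = s}"
      have RX: "?R \<subseteq> X" using R Y by auto
      have finR: "finite ?R" using finite_subset[OF RX less.prems] .
      have "card {w. (s', w) \<in> ?R} \<le> c" for s'
      proof (cases "s' = s")
        case True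
        then have "{w. (s', w) \<in> ?R} = {w. (s, w) \<in> X}" using R(1) by (auto simp: Y_def)
        with 3 show ?thesis by simp
      next
        case False
        then have "{w. (s', w) \<in> ?R} = {w. (s', w) \<in> R}" by auto
        with R show ?thesis by simp
      qed
      moreover have "card {s. (s, w') \<in> X} \<le> card {s. (s, w') \<in> ?R} + d" for w'
      proof (cases "(s, w') \<in> X")
        case True
        then have "{s. (s, w') \<in> X} = insert s {s. (s, w') \<in> Y}"
          "{s. (s, w') \<in> ?R} = insert s {s. (s, w') \<in> R}" by (auto simp: Y_def)
        moreover have "s \<notin> {s. (s, w') \<in> Y}" "s \<notin> {s. (s, w') \<in> R}"
          using R(1) by (auto simp: Y_def)
        ultimately show ?thesis
          using R(3)[of w'] fins[OF \<open>finite Y\<close>] fins[OF finite_subset[OF R(1) \<open>finite Y\<close>]]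
          by simp
      next
        case False
        then have "{s. (s, w') \<in> X} = {s. (s, w') \<in> Y}"
          "{s. (s, w') \<in> ?R} = {s. (s, w') \<in> R}" by (auto simp: Y_def)
        with R(3)[of w'] show ?thesis by simp
      qed
      ultimately show ?thesis using RX by (intro disjI2 exI[of _ ?R]) simp
    qed
  next
    case (4 s w)
    define Y where "Y = {(s', w'). (s', w') \<in> X \<and> w' \<noteq> w}"
    have Y: "Y \<subset> X" using 4 by (auto simp: Y_def)
    then have "finite Y" using less.prems finite_subset by blast
    with Y less have "?dense Y \<or> ?sparse Y" by (simp add: psubset_card_mono)
    then show ?thesis
    proof
      assume "?dense Y" with mono Y show ?thesis by blast
    next
      assume "?sparse Y"
      then obtain R where R: "R \<subseteq> Y" "\<And>s. card {w. (s, w) \<in> R} \<le> c"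
        "\<And>w. card {s. (s, w) \<in> Y} \<le> card {s. (s, w) \<in> R} + d" by blast
      have "card {s. (s, w') \<in> X} \<le> card {s. (s, w') \<in> R} + d" for w'
      proof (cases "w' = w")
        case True with 4 show ?thesis by simp
      next
        case False
        then have "{s. (s, w') \<in> X} = {s. (s, w') \<in> Y}" by (auto simp: Y_def)
        with R(3)[of w'] show ?thesis by simp
      qed
      moreover have "R \<subseteq> X" using R(1) Y by blast
      ultimately show ?thesis using R(2) by (intro disjI2 exI[of _ R]) simp
    qed
  qed
qed

lemma ex_outside:
  assumes "card B < card A" "finite B" shows "\<exists>x\<in>A. x \<notin> B"
  using assms by (metis card_mono leD subsetI)

lemma alternating_path:
  assumes F: "finite F" "(s0, w0) \<in> F"
    and E: "\<And>s w. (s, w) \<in> F \<Longrightarrow> E s w \<and> E w s"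
    and disj: "fst ` F \<inter> snd ` F = {}"
    and deg: "\<And>s w. (s, w) \<in> F \<Longrightarrow> a + m < card {w'. (s, w') \<in> F} \<and> m < card {s'. (s', w) \<in> F}"
    and branch: "\<And>s. card {w. (s, w) \<in> F \<and> b w = b w0} \<le> a"
    and "0 < m"
  obtains xs w where "length xs = 2 * m" "distinct (xs @ [w])" "successively E (xs @ [w])"
    "hd xs = w0" "w \<in> snd ` F" "b w \<noteq> b w0" "set xs \<subseteq> fst ` F \<union> snd ` F" "set xs \<inter> fst ` F \<noteq> {}"
proof -
  have "\<exists>xs w. length xs = 2 * l \<and> distinct (xs @ [w]) \<and> successively E (xs @ [w]) \<and>
    hd (xs @ [w]) = w0 \<and> w \<in> snd ` F \<and> (0 < l \<longrightarrow> b w \<noteq> b w0 \<and> set xs \<inter> fst ` F \<noteq> {}) \<and>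
    set xs \<subseteq> fst ` F \<union> snd ` F \<and>
    card (set xs \<inter> fst ` F) \<le> l \<and> card (set xs \<inter> snd ` F) \<le> l"
    if "l \<le> m" for l
    using that
  proof (induction l)
    case 0
    have "w0 \<in> snd ` F" using F(2) by force
    then show ?case by (intro exI[of _ "[]"] exI[of _ w0]) simp
  next
    case (Suc l)
    from Suc.IH[OF Suc_leD[OF Suc.prems]] obtain xs w where IH: "length xs = 2 * l" "distinct (xs @ [w])" "successively E (xs @ [w])"
      "hd (xs @ [w]) = w0" "w \<in> snd ` F" "set xs \<subseteq> fst ` F \<union> snd ` F"
      "card (set xs \<inter> fst ` F) \<le> l" "card (set xs \<inter> snd ` F) \<le> l"
      by blast
    obtain s' where "(s', w) \<in> F" using IH(5) by auto
    then have "m < card {s'. (s', w) \<in> F}" using deg by blast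
    then obtain s where s: "(s, w) \<in> F" "s \<notin> set xs \<inter> fst ` F"
      using ex_outside[of "set xs \<inter> fst ` F" "{s'. (s', w) \<in> F}"] IH(7) Suc.prems by auto
    have sF: "s \<in> fst ` F" "s \<notin> set xs" using s by force+
    have sw: "s \<noteq> w" "s \<notin> snd ` F" "w \<notin> fst ` F" using disj sF IH(5) by blast+
    \<comment> \<open>The current end \<open>w\<close> is not yet part of \<open>xs\<close>, hence
      the bound \<open>a + Suc l\<close> below rather than \<open>a + l\<close>; it is at most
      \<open>a + m\<close>.\<close>
    let ?B = "{w'. (s, w') \<in> F \<and> b w' = b w0} \<union> insert w (set xs \<inter> snd ` F)"
    have fin: "finite {w'. (s, w') \<in> F \<and> b w' = b w0}"
      by (rule finite_subset[OF _ finite_imageI[OF F(1), of snd]]) force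
    have "card ?B \<le> a + Suc l"
      using card_Un_le[of "{w'. (s, w') \<in> F \<and> b w' = b w0}" "insert w (set xs \<inter> snd ` F)"]
        branch[of s] card_insert_le_m1[of "Suc l" "set xs \<inter> snd ` F" w] IH(8)
      by simp
    moreover have "a + m < card {w'. (s, w') \<in> F}" using deg s by blast
    ultimately obtain w' where w': "(s, w') \<in> F" "w' \<notin> ?B"
      using ex_outside[of ?B "{w'. (s, w') \<in> F}"] fin Suc.prems by auto
    have "w' \<in> snd ` F" using w'(1) by force
    moreover have "w' \<noteq> w" "b w' \<noteq> b w0" "w' \<notin> set xs" using w' \<open>w' \<in> snd ` F\<close> by auto
    ultimately have w'F: "w' \<in> snd ` F" "w' \<notin> set xs" "w' \<noteq> w" "b w' \<noteq> b w0" "w' \<noteq> s" "w' \<notin> fst ` F"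
      using sF disj by blast+
    have card1: "card (set (xs @ [w, s]) \<inter> fst ` F) \<le> Suc l"
    proof -
      have "set (xs @ [w, s]) \<inter> fst ` F = insert s (set xs \<inter> fst ` F)" using sF sw by auto
      then show ?thesis using IH(7) sF by simp
    qed
    have card2: "card (set (xs @ [w, s]) \<inter> snd ` F) \<le> Suc l"
    proof -
      have "set (xs @ [w, s]) \<inter> snd ` F = insert w (set xs \<inter> snd ` F)" using IH(5) sw by auto
      then show ?thesis using IH(8) IH(2) by simp
    qed
    have succ: "successively E ((xs @ [w]) @ [s, w'])"
      using IH(3) E[OF s(1)] E[OF w'(1)] by (subst successively_append_iff) auto
    have "hd ((xs @ [w]) @ [s, w']) = w0" using IH(4) by (subst hd_append2) auto
    then show ?case
      using IH card1 card2 sF sw w'F succ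
      by (intro exI[of _ "xs @ [w, s]"] exI[of _ w']) auto
  qed
  from this[of m] obtain xs w where "length xs = 2 * m" "distinct (xs @ [w])"
    "successively E (xs @ [w])" "hd (xs @ [w]) = w0" "w \<in> snd ` F" "b w \<noteq> b w0"
    "set xs \<subseteq> fst ` F \<union> snd ` F" "set xs \<inter> fst ` F \<noteq> {}"
    using \<open>0 < m\<close> by blast
  moreover then have "hd xs = w0" using \<open>0 < m\<close> by (cases xs) auto
  ultimately show ?thesis using that by blast
qed

lemma successively_map_upt:
  assumes "\<And>j. a \<le> j \<Longrightarrow> Suc j < b \<Longrightarrow> E (f j) (f (Suc j))"
  shows "successively E (map f [a..<b])"
  using assms
proof (induction b)
  case (Suc b)
  show ?case
  proof (cases "a < b")
    case True
    then obtain b' where "b = Suc b'" by (cases b) auto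
    with Suc True show ?thesis by (simp add: successively_append_iff)
  next
    case False
    then show ?thesis by (cases "a \<le> b") (auto simp: successively_append_iff)
  qed
qed simp

text \<open>The list runs from \<open>Q 0\<close> to \<open>P 0\<close> along \<open>xs\<close>, up
  along \<open>P\<close>, and down along \<open>Q\<close> from \<open>v\<close> to
  \<open>Q 1\<close>, which is adjacent to \<open>Q 0\<close>. \<open>P\<close> and \<open>Q\<close>
  meet only in \<open>v\<close>, since different layers are disjoint and within one layer the two
  differ. Layer \<open>0\<close> is left out of these conditions because \<open>xs\<close> itself
  may use it.\<close>

lemma closed_path_merge:
  assumes sym: "\<And>x y. E x y \<Longrightarrow> E y x"
    and n: "0 < n"
    and P: "P n = v" "Q n = v"
    and edges: "\<And>j. j < n \<Longrightarrow> E (P j) (P (Suc j))" "\<And>j. j < n \<Longrightarrow> E (Q j) (Q (Suc j))"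
    and layer: "\<And>j. 1 \<le> j \<Longrightarrow> j \<le> n \<Longrightarrow> P j \<in> V j" "\<And>j. 1 \<le> j \<Longrightarrow> j \<le> n \<Longrightarrow> Q j \<in> V j"
    and disj: "\<And>i j. i \<noteq> j \<Longrightarrow> 1 \<le> i \<Longrightarrow> 1 \<le> j \<Longrightarrow> i \<le> n \<Longrightarrow> j \<le> n \<Longrightarrow> V i \<inter> V j = {}"
    and diff: "\<And>j. 1 \<le> j \<Longrightarrow> j < n \<Longrightarrow> P j \<noteq> Q j"
    and xs: "xs \<noteq> []" "hd xs = Q 0" "distinct (xs @ [P 0])" "successively E (xs @ [P 0])"
    and off: "\<And>j. 1 \<le> j \<Longrightarrow> j \<le> n \<Longrightarrow> V j \<inter> set (xs @ [P 0]) = {}"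
  shows "closed_path E (xs @ map P [0..<n] @ rev (map Q [1..<Suc n]))"
proof -
  let ?A = "map P [0..<n]" and ?B = "map Q [1..<Suc n]"
  have ne: "?A \<noteq> []" "?B \<noteq> []" using n by auto
  have injP: "P i \<noteq> P j" if "i < j" "j \<le> n" for i j
  proof (cases "i = 0")
    case True
    then show ?thesis using that off[of j] layer(1)[of j] by auto
  next
    case False
    then show ?thesis using that layer(1)[of i] layer(1)[of j] disj[of i j] by auto
  qed
  have "inj_on P {0..<n}"
    by (rule linorder_inj_onI) (use injP in auto)
  moreover have "inj_on Q {1..<Suc n}"
  proof (rule linorder_inj_onI)
    fix i j assume "i < j" "i \<in> {1..<Suc n}" "j \<in> {1..<Suc n}"
    then show "Q i \<noteq> Q j" using layer(2)[of i] layer(2)[of j] disj[of i j] by auto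
  qed auto
  moreover have "P i \<notin> set xs" if "i < n" for i
    using xs(3) off[of i] layer(1)[of i] that by (cases "i = 0") auto
  moreover have "Q j \<notin> set xs" if "1 \<le> j" "j \<le> n" for j
    using off[of j] layer(2)[of j] that by auto
  moreover have "P i \<noteq> Q j" if "i < n" "1 \<le> j" "j \<le> n" for i j
  proof -
    consider "i = 0" | "i \<noteq> 0" "i = j" | "i \<noteq> 0" "i \<noteq> j" by blast
    then show ?thesis
    proof cases
      case 1 then show ?thesis using off[of j] layer(2)[of j] that by auto
    next
      case 2 then show ?thesis using diff[of i] that by auto
    next
      case 3 then show ?thesis using layer(1)[of i] layer(2)[of j] disj[of i j] that by auto
    qed
  qed
  ultimately have "distinct (xs @ ?A @ rev ?B)"
    using xs(3) by (auto simp: distinct_map simp del: upt_Suc)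
  moreover have "successively E (xs @ ?A @ rev ?B)"
  proof -
    have 1: "successively E xs" "E (last xs) (P 0)"
      using xs by (auto simp: successively_append_iff)
    have 2: "successively E ?A"
      by (rule successively_map_upt) (use edges in auto)
    have "successively (\<lambda>x y. E y x) ?B"
      by (rule successively_map_upt) (use edges sym in auto)
    then have 3: "successively E (rev ?B)" by simp
    have "last ?A = P (n - 1)" "hd (rev ?B) = v" using n P by (auto simp: last_map hd_rev)
    then have 4: "E (last ?A) (hd (rev ?B))" using edges(1)[of "n - 1"] n P by simp
    have "hd ?A = P 0" using n by (simp add: hd_map)
    then show ?thesis
      using 1 2 3 4 ne by (auto simp: successively_append_iff hd_append simp del: upt_Suc)
  qed
  moreover have "last (xs @ ?A @ rev ?B) = Q 1"
    using ne(2) by (simp add: last_rev hd_map del: upt_Suc)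
  moreover have "E (Q 1) (Q 0)" using edges(2)[of 0] n sym by simp
  ultimately show ?thesis using xs by (auto simp: closed_path_def)
qed

text \<open>
  The set \<open>R\<close> keeps the degrees on the side of \<open>S\<close> bounded from
  layer to layer, while every origin of \<open>v\<close> loses at most \<open>k\<close> of
  its edges per layer. If the peeling gets stuck, an alternating path between two origins
  whose paths to \<open>v\<close> are disjoint yields a \<open>2k\<close>-cycle through
  \<open>S\<close>.
\<close>

lemma sparse_orientation:
  assumes sym: "\<And>x y. E x y \<Longrightarrow> E y x"
    and finS: "finite S" and finV: "finite (V 0)"
    and disjV: "\<And>i j. i \<noteq> j \<Longrightarrow> i < k \<Longrightarrow> j < k \<Longrightarrow> V i \<inter> V j = {}"
    and disjS: "\<And>i. i < k \<Longrightarrow> V i \<inter> S = {}"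
    and rich: "\<And>w. w \<in> V 0 \<Longrightarrow> k\<^sup>2 \<le> card {s \<in> S. E s w}"
    and nocyc: "\<And>xs. closed_path E xs \<Longrightarrow> length xs = 2 * k \<Longrightarrow> set xs \<inter> S = {}"
    and "i < k"
  shows "\<exists>R \<subseteq> {(s, w). s \<in> S \<and> w \<in> layer_origins E V i v \<and> E s w}.
    (\<forall>s. card {w. (s, w) \<in> R} \<le> 1 + i * k) \<and>
    (\<forall>w \<in> layer_origins E V i v. k\<^sup>2 \<le> card {s. (s, w) \<in> R} + i * k)"
  using \<open>i < k\<close>
proof (induction i arbitrary: v)
  case 0
  let ?R = "{(s, w). s \<in> S \<and> w \<in> layer_origins E V 0 v \<and> E s w}"
  have "card {w. (s, w) \<in> ?R} \<le> 1" for s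
    using card_mono[of "{v}" "{w. (s, w) \<in> ?R}"] by (auto simp: layer_origins_0)
  moreover have "k\<^sup>2 \<le> card {s. (s, w) \<in> ?R}" if "w \<in> layer_origins E V 0 v" for w
    using rich[of w] that by (auto simp: layer_origins_0)
  ultimately show ?case by (intro exI[of _ ?R]) auto
next
  case (Suc i)
  then have "\<forall>u. \<exists>R. R \<subseteq> {(s, w). s \<in> S \<and> w \<in> layer_origins E V i u \<and> E s w} \<and>
    (\<forall>s. card {w. (s, w) \<in> R} \<le> 1 + i * k) \<and>
    (\<forall>w \<in> layer_origins E V i u. k\<^sup>2 \<le> card {s. (s, w) \<in> R} + i * k)" by simp
  from choice[OF this] obtain R where
    R: "\<And>u. R u \<subseteq> {(s, w). s \<in> S \<and> w \<in> layer_origins E V i u \<and> E s w}"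
    "\<And>u s. card {w. (s, w) \<in> R u} \<le> 1 + i * k"
    "\<And>u w. w \<in> layer_origins E V i u \<Longrightarrow> k\<^sup>2 \<le> card {s. (s, w) \<in> R u} + i * k"
    by blast
  let ?W = "layer_origins E V (Suc i) v"
  obtain P where P: "\<And>w. w \<in> ?W \<Longrightarrow> P w 0 = w \<and> P w (Suc i) = v \<and> (\<forall>j\<le>Suc i. P w j \<in> V j) \<and>
       (\<forall>j<Suc i. E (P w j) (P w (Suc j)))"
    and merge: "\<And>w w' j l. P w j = P w' j \<Longrightarrow> j \<le> l \<Longrightarrow> P w l = P w' l"
    by (rule merging_paths[of E V "Suc i" v]) blast
  \<comment> \<open>\<open>b w\<close> is the branch of \<open>w\<close>, the node through which its
    chosen path enters \<open>v\<close>. The edges of \<open>w\<close> in \<open>X\<close> are those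
    that survived for this branch.\<close>
  define b where "b = (\<lambda>w. P w i)"
  have bw: "w \<in> layer_origins E V i (b w)" if "w \<in> ?W" for w
    using P[OF that] unfolding layer_origins_def b_def by (intro CollectI exI[of _ "P w"]) auto
  define X where "X = {(s, w). w \<in> ?W \<and> (s, w) \<in> R (b w)}"
  have XS: "X \<subseteq> {(s, w). s \<in> S \<and> w \<in> ?W \<and> E s w}"
    using R(1) by (force simp: X_def)
  then have "X \<subseteq> S \<times> V 0" using layer_origins_subset[of E V "Suc i" v] by auto
  then have finX: "finite X" using finS finV finite_subset by blast
  have degX: "k\<^sup>2 \<le> card {s. (s, w) \<in> X} + i * k" if "w \<in> ?W" for w
    using R(3)[OF bw[OF that]] that by (simp add: X_def)
  \<comment> \<open>The sparse outcome is literally the claim for \<open>Suc i\<close>; the dense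
    one is refuted.\<close>
  from bipartite_peeling[OF finX, of "1 + Suc i * k" k] show ?case
  proof (elim disjE exE conjE)
    fix Q assume 2: "Q \<subseteq> X" "\<forall>s. card {w. (s, w) \<in> Q} \<le> 1 + Suc i * k"
       "\<forall>w. card {s. (s, w) \<in> X} \<le> card {s. (s, w) \<in> Q} + k"
    have "k\<^sup>2 \<le> card {s. (s, w) \<in> Q} + Suc i * k" if "w \<in> ?W" for w
      using degX[OF that] spec[OF 2(3), of w] by simp
    moreover have "Q \<subseteq> {(s, w). s \<in> S \<and> w \<in> ?W \<and> E s w}" using 2(1) XS by (rule subset_trans)
    ultimately show ?case using 2(2) by (intro exI[of _ Q]) simp
  next
    fix F assume 1: "F \<subseteq> X" "F \<noteq> {}"
      "\<forall>(s, w)\<in>F. 1 + Suc i * k < card {w'. (s, w') \<in> F} \<and> k < card {s'. (s', w) \<in> F}"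
    \<comment> \<open>An alternating path contributes \<open>2 * m\<close> nodes before its end, and
      the two paths to \<open>v\<close> contribute \<open>Suc i\<close> each, which makes
      \<open>2 * k\<close>.\<close>
    define m where "m = k - Suc i"
    have m: "0 < m" "m + Suc i = k" using Suc.prems by (auto simp: m_def)
    obtain s0 w0 where sw0: "(s0, w0) \<in> F" using 1(2) by auto
    have FW: "s \<in> S \<and> w \<in> ?W \<and> E s w" if "(s, w) \<in> F" for s w using that 1(1) XS by blast
    have W0: "?W \<subseteq> V 0" by (rule layer_origins_subset)
    have fF: "fst ` F \<subseteq> S" "snd ` F \<subseteq> V 0" using FW W0 by force+
    have f1: "finite F" using 1(1) finX finite_subset by blast
    have f3: "fst ` F \<inter> snd ` F = {}" using fF disjS[of 0] Suc.prems by auto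
    have f4: "1 + i * k + m < card {w'. (s, w') \<in> F} \<and> m < card {s'. (s', w) \<in> F}"
      if "(s, w) \<in> F" for s w
    proof -
      have "1 + Suc i * k < card {w'. (s, w') \<in> F} \<and> k < card {s'. (s', w) \<in> F}"
        using 1(3) that by blast
      with m show ?thesis by (auto simp: algebra_simps)
    qed
    \<comment> \<open>All edges into one branch lie in the same \<open>R (b w0)\<close>, so the
      induction hypothesis bounds how many neighbours of \<open>s\<close> have to be avoided. The
      additional \<open>k\<close> in the peeling threshold pays for the \<open>m\<close> nodes used
      by the path.\<close>
    have f5: "card {w. (s, w) \<in> F \<and> b w = b w0} \<le> 1 + i * k" for s
    proof -
      have "R (b w0) \<subseteq> S \<times> V 0" using R(1)[of "b w0"] layer_origins_subset[of E V i "b w0"] by auto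
      then have "{w. (s, w) \<in> R (b w0)} \<subseteq> V 0" by auto
      then have "finite {w. (s, w) \<in> R (b w0)}" using finV finite_subset by blast
      moreover have "{w. (s, w) \<in> F \<and> b w = b w0} \<subseteq> {w. (s, w) \<in> R (b w0)}"
        using 1(1) by (auto simp: X_def)
      ultimately show ?thesis using card_mono R(2)[where u = "b w0" and s = s] le_trans by blast
    qed
    have f2: "E s w \<and> E w s" if "(s, w) \<in> F" for s w using FW[OF that] sym by blast
    obtain xs w where xs: "length xs = 2 * m" "distinct (xs @ [w])"
      "successively E (xs @ [w])" "hd xs = w0" "w \<in> snd ` F" "b w \<noteq> b w0"
      "set xs \<subseteq> fst ` F \<union> snd ` F" "set xs \<inter> fst ` F \<noteq> {}"
      by (rule alternating_path[OF f1 sw0 f2 f3 f4 f5 m(1)])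
    have wW: "w \<in> ?W" "w0 \<in> ?W" using xs(5) sw0 FW by force+
    note Pw = P[OF wW(1)] and Pw0 = P[OF wW(2)]
    have "w \<in> V 0" using wW(1) W0 by blast
    then have sub: "set (xs @ [P w 0]) \<subseteq> S \<union> V 0" using xs(7) fF Pw by auto
    have "closed_path E (xs @ map (P w) [0..<Suc i] @ rev (map (P w0) [1..<Suc (Suc i)]))"
    proof (rule closed_path_merge[where V = V and v = v])
      fix j assume j: "1 \<le> j" "j < Suc i"
      then show "P w j \<noteq> P w0 j" using merge[of w j w0 i] xs(6) by (auto simp: b_def)
    next
      fix j assume j: "1 \<le> j" "j \<le> Suc i"
      then show "V j \<inter> set (xs @ [P w 0]) = {}"
        using sub disjS[of j] disjV[of j 0] Suc.prems by auto
    next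
      fix j l assume "j \<noteq> l" "j \<le> Suc i" "l \<le> Suc i"
      then show "V j \<inter> V l = {}" using disjV[of j l] Suc.prems by auto
    qed (use Pw Pw0 xs m sym in \<open>auto simp del: upt_Suc\<close>)
    moreover have "length (xs @ map (P w) [0..<Suc i] @ rev (map (P w0) [1..<Suc (Suc i)])) = 2 * k"
      using xs(1) m by simp
    ultimately have "set (xs @ map (P w) [0..<Suc i] @ rev (map (P w0) [1..<Suc (Suc i)])) \<inter> S = {}"
      by (rule nocyc)
    then have "set xs \<inter> S = {}" by auto
    with xs(8) fF have False by blast
    then show ?case ..
  qed
qed

text \<open>Every origin keeps an edge of \<open>R\<close>, because \<open>k^2 - i * k > 0\<close>.
  Hence the origins are covered by the \<open>R\<close>-neighbourhoods of the nodes of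
  \<open>S\<close>, each of size at most \<open>1 + i * k <= k^2\<close>.\<close>

theorem layer_origins_sparse:
  assumes sym: "\<And>x y. E x y \<Longrightarrow> E y x"
    and finS: "finite S" and finV: "finite (V 0)"
    and disjV: "\<And>i j. i \<noteq> j \<Longrightarrow> i < k \<Longrightarrow> j < k \<Longrightarrow> V i \<inter> V j = {}"
    and disjS: "\<And>i. i < k \<Longrightarrow> V i \<inter> S = {}"
    and rich: "\<And>w. w \<in> V 0 \<Longrightarrow> k\<^sup>2 \<le> card {s \<in> S. E s w}"
    and nocyc: "\<And>xs. closed_path E xs \<Longrightarrow> length xs = 2 * k \<Longrightarrow> set xs \<inter> S = {}"
    and "i < k"
  shows "card (layer_origins E V i v) \<le> k\<^sup>2 * card S"
proof -
  let ?W = "layer_origins E V i v"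
  have "\<exists>R \<subseteq> {(s, w). s \<in> S \<and> w \<in> ?W \<and> E s w}. (\<forall>s. card {w. (s, w) \<in> R} \<le> 1 + i * k) \<and>
    (\<forall>w \<in> ?W. k\<^sup>2 \<le> card {s. (s, w) \<in> R} + i * k)"
    by (rule sparse_orientation[of E S V k i v]) (fact assms)+
  then obtain R where
    R: "R \<subseteq> {(s, w). s \<in> S \<and> w \<in> ?W \<and> E s w}" and R2: "\<forall>s. card {w. (s, w) \<in> R} \<le> 1 + i * k"
    and R3: "\<forall>w\<in>?W. k\<^sup>2 \<le> card {s. (s, w) \<in> R} + i * k"
    by (elim exE conjE)
  have "1 + i * k \<le> k\<^sup>2"
  proof -
    have "Suc i * k \<le> k * k" using \<open>i < k\<close> by (intro mult_le_mono) auto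
    then show ?thesis using \<open>i < k\<close> by (simp add: power2_eq_square)
  qed
  have "?W \<subseteq> (\<Union>s\<in>S. {w. (s, w) \<in> R})"
  proof
    fix w assume w: "w \<in> ?W"
    have "0 < card {s. (s, w) \<in> R}" using bspec[OF R3 w] \<open>1 + i * k \<le> k\<^sup>2\<close> by simp
    then have "{s. (s, w) \<in> R} \<noteq> {}" by (metis card.empty less_irrefl)
    then show "w \<in> (\<Union>s\<in>S. {w. (s, w) \<in> R})" using R by auto
  qed
  moreover have "finite (\<Union>s\<in>S. {w. (s, w) \<in> R})"
  proof -
    have "(\<Union>s\<in>S. {w. (s, w) \<in> R}) \<subseteq> V 0" using R layer_origins_subset[of E V i v] by auto
    then show ?thesis using finV finite_subset by blast
  qed
  ultimately have "card ?W \<le> card (\<Union>s\<in>S. {w. (s, w) \<in> R})" by (rule card_mono[rotated])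
  also have "\<dots> \<le> (\<Sum>s\<in>S. card {w. (s, w) \<in> R})" using finS by (rule card_UN_le)
  also have "\<dots> \<le> (\<Sum>s\<in>S. k\<^sup>2)" using R2 \<open>1 + i * k \<le> k\<^sup>2\<close> by (intro sum_mono) (meson le_trans)
  finally show ?thesis by (simp add: mult.commute)
qed

section \<open>Coin tossing\<close>

lemma prob_bind_pmf_le:
  assumes "\<And>x. x \<in> set_pmf M \<Longrightarrow> x \<in> A \<Longrightarrow> measure_pmf.prob (N x) X \<le> q"
    and "\<And>x. x \<in> set_pmf M \<Longrightarrow> x \<notin> A \<Longrightarrow> measure_pmf.prob (N x) X = 0" and "0 \<le> q"
  shows "measure_pmf.prob (bind_pmf M N) X \<le> measure_pmf.prob M A * q"
proof -
  have "emeasure (bind_pmf M N) X = (\<integral>\<^sup>+x. emeasure (N x) X \<partial>M)" by simp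
  also have "\<dots> \<le> (\<integral>\<^sup>+x. ennreal q * indicator A x \<partial>M)"
    by (intro nn_integral_mono_AE AE_pmfI)
      (use assms in \<open>auto simp: indicator_def measure_pmf.emeasure_eq_measure ennreal_leI\<close>)
  also have "\<dots> = ennreal (measure_pmf.prob M A * q)"
    using assms(3) by (simp add: nn_integral_cmult measure_pmf.emeasure_eq_measure ennreal_mult mult.commute)
  finally show ?thesis
    using assms(3) by (simp add: measure_pmf.emeasure_eq_measure)
qed

lemma prob_bind_pmf_ge:
  assumes "\<And>x. x \<in> set_pmf M \<Longrightarrow> x \<in> A \<Longrightarrow> q \<le> measure_pmf.prob (N x) X" and "0 \<le> q"
  shows "measure_pmf.prob M A * q \<le> measure_pmf.prob (bind_pmf M N) X"
proof -
  have "ennreal (measure_pmf.prob M A * q) = (\<integral>\<^sup>+x. ennreal q * indicator A x \<partial>M)"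
    using assms(2) by (simp add: nn_integral_cmult measure_pmf.emeasure_eq_measure ennreal_mult mult.commute)
  also have "\<dots> \<le> (\<integral>\<^sup>+x. emeasure (N x) X \<partial>M)"
    by (intro nn_integral_mono_AE AE_pmfI)
      (use assms in \<open>auto simp: indicator_def measure_pmf.emeasure_eq_measure ennreal_leI\<close>)
  also have "\<dots> = emeasure (bind_pmf M N) X" by simp
  finally show ?thesis
    by (simp add: measure_pmf.emeasure_eq_measure)
qed

section \<open>Independent blocks of fair coins\<close>

definition coin_strings :: "nat \<Rightarrow> bool list pmf" where
  "coin_strings l = pmf_of_set {bs. length bs = l}"

lemma finite_bool_lists: "finite {bs :: bool list. length bs = l}"
  using finite_lists_length_eq[of "UNIV :: bool set" l] by simp

lemma card_bool_lists: "card {bs :: bool list. length bs = l} = 2 ^ l"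
  using card_lists_length_eq[of "UNIV :: bool set" l] by simp

lemma bool_lists_nonempty: "{bs :: bool list. length bs = l} \<noteq> {}"
  by (metis (mono_tags, lifting) length_replicate mem_Collect_eq empty_iff)

lemma set_coin_strings: "set_pmf (coin_strings l) = {bs. length bs = l}"
  by (simp add: coin_strings_def set_pmf_of_set[OF bool_lists_nonempty finite_bool_lists])

lemma pmf_coin_strings: "pmf (coin_strings l) bs = (if length bs = l then 1 / 2 ^ l else 0)"
  by (simp add: coin_strings_def pmf_of_set[OF bool_lists_nonempty finite_bool_lists] card_bool_lists)

text \<open>This permits cutting the single coin string of a node into trials, and each trial into
  sample bits and colour bits.\<close>

lemma coin_strings_add:
  "coin_strings (a + b) = bind_pmf (coin_strings a) (\<lambda>xs. map_pmf ((@) xs) (coin_strings b))"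
proof (rule pmf_eqI)
  fix bs :: "bool list"
  have *: "pmf (map_pmf ((@) xs) (coin_strings b)) bs =
      (if xs = take a bs then (if length bs = a + b then 1 / 2 ^ b else 0) else 0)"
    if "length xs = a" for xs
  proof (cases "xs = take a bs")
    case True
    then have "bs = xs @ drop a bs" by simp
    then have "pmf (map_pmf ((@) xs) (coin_strings b)) bs = pmf (coin_strings b) (drop a bs)"
      by (metis (no_types, lifting) injI pmf_map_inj' same_append_eq)
    moreover have "length bs = a + b \<longleftrightarrow> length (drop a bs) = b"
      using \<open>bs = xs @ drop a bs\<close> that by (metis length_append add_left_cancel)
    ultimately show ?thesis using True by (simp add: pmf_coin_strings)
  next
    case False
    then have "bs \<notin> (@) xs ` UNIV" using that by auto
    then have "bs \<notin> set_pmf (map_pmf ((@) xs) (coin_strings b))" by auto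
    then have "pmf (map_pmf ((@) xs) (coin_strings b)) bs = 0" by (metis set_pmf_iff)
    with False show ?thesis by simp
  qed
  have "pmf (bind_pmf (coin_strings a) (\<lambda>xs. map_pmf ((@) xs) (coin_strings b))) bs =
      (\<Sum>xs\<in>{xs. length xs = a}. pmf (map_pmf ((@) xs) (coin_strings b)) bs / 2 ^ a)"
    by (subst coin_strings_def)
      (simp add: pmf_bind_pmf_of_set[OF bool_lists_nonempty finite_bool_lists] card_bool_lists sum_divide_distrib)
  also have "\<dots> = (\<Sum>xs\<in>{xs. length xs = a}.
      if xs = take a bs then (if length bs = a + b then 1 / 2 ^ (a + b) else 0) else 0)"
    by (intro sum.cong refl, subst *) (auto simp: power_add)
  also have "\<dots> = (if length bs = a + b then 1 / 2 ^ (a + b) else 0)"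
    by (simp add: sum.delta finite_bool_lists)
  finally show "pmf (coin_strings (a + b)) bs =
      pmf (bind_pmf (coin_strings a) (\<lambda>xs. map_pmf ((@) xs) (coin_strings b))) bs"
    by (simp add: pmf_coin_strings)
qed

definition node_coins :: "'a set \<Rightarrow> nat \<Rightarrow> ('a \<Rightarrow> bool list) pmf" where
  "node_coins V l = Pi_pmf V [] (\<lambda>_. coin_strings l)"

lemma length_node_coins:
  "finite V \<Longrightarrow> f \<in> set_pmf (node_coins V l) \<Longrightarrow> length (f v) = (if v \<in> V then l else 0)"
  by (auto simp: node_coins_def set_Pi_pmf PiE_dflt_def set_coin_strings)

lemma node_coins_add:
  assumes "finite V"
  shows "node_coins V (a + b) =
    bind_pmf (node_coins V a) (\<lambda>f. map_pmf (\<lambda>g v. f v @ g v) (node_coins V b))"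
proof -
  have 1: "Pi_pmf V [] (\<lambda>v. map_pmf ((@) (f v)) (coin_strings b)) =
      map_pmf (\<lambda>g v. f v @ g v) (node_coins V b)" if f: "f \<in> set_pmf (node_coins V a)" for f
  proof -
    have "Pi_pmf V [] (\<lambda>v. map_pmf ((@) (f v)) (coin_strings b)) =
       bind_pmf (node_coins V b) (\<lambda>g. Pi_pmf V [] (\<lambda>v. return_pmf (f v @ g v)))"
      unfolding node_coins_def map_pmf_def by (rule Pi_pmf_bind) (rule assms)
    also have "\<dots> = map_pmf (\<lambda>g v. f v @ g v) (node_coins V b)"
      unfolding map_pmf_def
    proof (rule bind_pmf_cong[OF refl])
      fix g assume "g \<in> set_pmf (node_coins V b)"
      \<comment> \<open>Outside \<open>V\<close> both strings are the default \<open>[]\<close>, and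
        so is their concatenation.\<close>
      then have "(if v \<in> V then f v @ g v else []) = f v @ g v" for v
        using length_node_coins[OF assms f, of v] length_node_coins[OF assms \<open>g \<in> _\<close>, of v] by auto
      then show "Pi_pmf V [] (\<lambda>v. return_pmf (f v @ g v)) = return_pmf (\<lambda>v. f v @ g v)"
        using assms by simp
    qed
    finally show ?thesis .
  qed
  have "node_coins V (a + b) = bind_pmf (node_coins V a)
      (\<lambda>f. Pi_pmf V [] (\<lambda>v. map_pmf ((@) (f v)) (coin_strings b)))"
    unfolding node_coins_def coin_strings_add by (rule Pi_pmf_bind) (rule assms)
  also have "\<dots> = bind_pmf (node_coins V a) (\<lambda>f. map_pmf (\<lambda>g v. f v @ g v) (node_coins V b))"
    by (rule bind_pmf_cong) (auto simp: 1)
  finally show ?thesis .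
qed

text \<open>The first \<open>l\<close> coins of every node decide the first trial and are
  independent of the rest, in which the remaining trials reappear with their index shifted by
  one.\<close>

lemma prob_all_trials_fail:
  assumes V: "finite V"
    and q: "q \<le> measure_pmf.prob (node_coins V l) {g. hit g}" "0 \<le> q" "q \<le> 1"
  shows "measure_pmf.prob (node_coins V (R * l)) {r. \<forall>t<R. \<not> hit (\<lambda>v. take l (drop (t * l) (r v)))}
    \<le> (1 - q) ^ R"
proof (induction R)
  case 0
  show ?case by simp
next
  case (Suc R)
  let ?X = "\<lambda>R. {r :: 'a \<Rightarrow> bool list. \<forall>t<R. \<not> hit (\<lambda>v. take l (drop (t * l) (r v)))}"
  have split: "(\<lambda>v. f v @ g v) \<in> ?X (Suc R) \<longleftrightarrow> \<not> hit f \<and> g \<in> ?X R"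
    if f: "f \<in> set_pmf (node_coins V l)" and g: "g \<in> set_pmf (node_coins V (R * l))" for f g
  proof -
    note len = length_node_coins[OF V f] length_node_coins[OF V g]
    have 0: "take l (f v @ g v) = f v" for v
      using len[of v] by (cases "v \<in> V") auto
    have S: "take l (drop (Suc t * l) (f v @ g v)) = take l (drop (t * l) (g v))" for t v
      using len[of v] by (cases "v \<in> V") (auto simp: add.commute)
    show ?thesis
      unfolding mem_Collect_eq All_less_Suc2 S by (simp only: 0 mult_0 drop_0)
  qed
  have "measure_pmf.prob (node_coins V (l + R * l)) (?X (Suc R)) \<le>
      measure_pmf.prob (node_coins V l) {f. \<not> hit f} * (1 - q) ^ R"
    unfolding node_coins_add[OF V]
  proof (rule prob_bind_pmf_le)
    fix f assume f: "f \<in> set_pmf (node_coins V l)"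
    let ?N = "map_pmf (\<lambda>g v. f v @ g v) (node_coins V (R * l))"
    have eq: "measure_pmf.prob ?N (?X (Suc R)) =
        measure_pmf.prob (node_coins V (R * l)) {g. \<not> hit f \<and> g \<in> ?X R}"
      unfolding measure_map_pmf
      by (rule measure_pmf.finite_measure_eq_AE) (use split[OF f] in \<open>auto intro!: AE_pmfI\<close>)
    show "f \<in> {f. \<not> hit f} \<Longrightarrow> measure_pmf.prob ?N (?X (Suc R)) \<le> (1 - q) ^ R"
      unfolding eq using Suc.IH by simp
    show "f \<notin> {f. \<not> hit f} \<Longrightarrow> measure_pmf.prob ?N (?X (Suc R)) = 0"
      unfolding eq by simp
  qed (use q in simp)
  also have "\<dots> \<le> (1 - q) * (1 - q) ^ R"
  proof (rule mult_right_mono)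
    have "measure_pmf.prob (node_coins V l) {f. \<not> hit f} =
        1 - measure_pmf.prob (node_coins V l) {f. hit f}"
      using measure_pmf.prob_compl[of "{f. hit f}" "node_coins V l"] by (simp add: Compl_eq_Diff_UNIV[symmetric] Collect_neg_eq)
    then show "measure_pmf.prob (node_coins V l) {f. \<not> hit f} \<le> 1 - q" using q by simp
  qed (use q in simp)
  finally show ?case by simp
qed

text \<open>Here \<open>f\<close> will be the sample bits and \<open>h\<close> the colour bits. The
  bound \<open>q\<close> is asked for each good \<open>f\<close> separately, so the cycle to be
  coloured may depend on \<open>f\<close>.\<close>

lemma prob_trial_ge:
  assumes V: "finite V"
    and "\<And>f. f \<in> set_pmf (node_coins V a) \<Longrightarrow> f \<in> A \<Longrightarrow>
      q \<le> measure_pmf.prob (node_coins V b) {h. hit (\<lambda>v. f v @ h v)}" "0 \<le> q"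
  shows "measure_pmf.prob (node_coins V a) A * q \<le> measure_pmf.prob (node_coins V (a + b)) {g. hit g}"
  unfolding node_coins_add[OF V]
  by (rule prob_bind_pmf_ge) (use assms in \<open>auto simp: measure_map_pmf vimage_def\<close>)

lemma prob_coin_strings_singleton:
  "measure_pmf.prob (coin_strings l) {bs} = (if length bs = l then 1 / 2 ^ l else 0)"
  by (simp add: measure_pmf_single pmf_coin_strings)

text \<open>The nodes of the list are distinct, so the requirement contains a product event with
  factor \<open>1 / 2 ^ d\<close> at each of them and \<open>1\<close> elsewhere.\<close>

lemma prob_prescribed_coins:
  assumes V: "finite V" and xs: "distinct xs" "set xs \<subseteq> V"
    and code: "\<And>i. i < length xs \<Longrightarrow> length (code i) = d"
  shows "(1 / 2 ^ d) ^ length xs \<le>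
    measure_pmf.prob (node_coins V d) {h. \<forall>i<length xs. h (xs ! i) = code i}"
proof -
  define B where "B v = {y. \<forall>i<length xs. xs ! i = v \<longrightarrow> y = code i}" for v
  have "(1 / 2 ^ d) ^ length xs = (1 / 2 ^ d :: real) ^ card (set xs)"
    using xs by (simp add: distinct_card)
  also have "\<dots> = (\<Prod>v\<in>V. if v \<in> set xs then 1 / 2 ^ d else 1)"
    using xs(2) V by (simp add: prod.If_cases Int_absorb1)
  also have "\<dots> \<le> (\<Prod>v\<in>V. measure_pmf.prob (coin_strings d) (B v))"
  proof (intro prod_mono conjI)
    fix v assume "v \<in> V"
    show "(if v \<in> set xs then 1 / 2 ^ d else 1) \<le> measure_pmf.prob (coin_strings d) (B v)"
    proof (cases "v \<in> set xs")
      case True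
      then obtain i where i: "i < length xs" "xs ! i = v" by (auto simp: in_set_conv_nth)
      then have "{code i} \<subseteq> B v" using xs(1) by (auto simp: B_def nth_eq_iff_index_eq)
      then have "measure_pmf.prob (coin_strings d) {code i} \<le> measure_pmf.prob (coin_strings d) (B v)"
        by (intro measure_pmf.finite_measure_mono) auto
      with True i code show ?thesis by (simp add: prob_coin_strings_singleton)
    next
      case False
      then have "B v = UNIV" by (auto simp: B_def)
      with False show ?thesis by simp
    qed
  qed simp
  also have "\<dots> = measure_pmf.prob (node_coins V d) (Pi V B)"
    unfolding node_coins_def using V by (rule measure_Pi_pmf_Pi[symmetric])
  also have "\<dots> \<le> measure_pmf.prob (node_coins V d) {h. \<forall>i<length xs. h (xs ! i) = code i}"
  proof (intro measure_pmf.finite_measure_mono subsetI CollectI allI impI)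
    fix h i assume "h \<in> Pi V B" "i < length xs"
    moreover then have "xs ! i \<in> V" using xs(2) by auto
    ultimately have "h (xs ! i) \<in> B (xs ! i)" by auto
    then show "h (xs ! i) = code i" using \<open>i < length xs\<close> by (simp add: B_def)
  qed simp
  finally show ?thesis .
qed

section \<open>Size of a random sample and its share of a large neighbourhood\<close>

definition sampled :: "('a \<Rightarrow> bool list) \<Rightarrow> nat \<Rightarrow> 'a \<Rightarrow> bool" where
  "sampled f b v \<longleftrightarrow> f v = replicate b True"

lemma prob_sampled:
  assumes "finite V" "v \<in> V"
  shows "measure_pmf.prob (node_coins V b) {f. sampled f b v} = 1 / 2 ^ b"
proof -
  have "map_pmf (\<lambda>f. f v) (node_coins V b) = coin_strings b"
    using assms by (simp add: node_coins_def Pi_pmf_component)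
  then have "measure_pmf.prob (coin_strings b) {replicate b True} =
      measure_pmf.prob (node_coins V b) ((\<lambda>f. f v) -` {replicate b True})"
    by (metis measure_map_pmf)
  then show ?thesis by (simp add: prob_coin_strings_singleton vimage_def sampled_def)
qed

text \<open>Markov's inequality at four times the mean \<open>card V / 2 ^ b\<close>.\<close>

lemma prob_many_sampled:
  assumes V: "finite V" and "V \<noteq> {}"
  shows "measure_pmf.prob (node_coins V b) {f. 4 * card V \<le> 2 ^ b * card {v \<in> V. sampled f b v}} \<le> 1 / 4"
proof -
  let ?M = "node_coins V b"
  let ?u = "\<lambda>f. \<Sum>v\<in>V. indicator {f. sampled f b v} f :: real"
  have u: "?u f = card {v \<in> V. sampled f b v}" for f
    using V by (simp add: indicator_def sum.If_cases Int_def)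
  have int: "integrable ?M (\<lambda>f. indicator {f. sampled f b v} f :: real)" for v
    by (rule integrable_real_indicator) (auto simp: measure_pmf.emeasure_eq_measure)
  have "measure_pmf.expectation ?M ?u = (\<Sum>v\<in>V. measure_pmf.prob ?M {f. sampled f b v})"
    by (subst Bochner_Integration.integral_sum) (use int in auto)
  also have "\<dots> = card V / 2 ^ b" using V by (simp add: prob_sampled)
  finally have E: "measure_pmf.expectation ?M ?u = card V / 2 ^ b" .
  have n: "0 < card V" using assms by (simp add: card_gt_0_iff)
  have "measure_pmf.prob ?M {f \<in> space ?M. real (4 * card V) / 2 ^ b \<le> ?u f} \<le>
      measure_pmf.expectation ?M ?u / (real (4 * card V) / 2 ^ b)"
    by (rule integral_Markov_inequality_measure[where A = UNIV])
      (use int n in \<open>auto intro!: sum_nonneg\<close>)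
  also have "\<dots> = 1 / 4" using n by (simp add: E)
  also have "{f \<in> space ?M. real (4 * card V) / 2 ^ b \<le> ?u f} =
      {f. 4 * card V \<le> 2 ^ b * card {v \<in> V. sampled f b v}}"
  proof -
    have "real (4 * card V) / 2 ^ b \<le> real m \<longleftrightarrow> 4 * card V \<le> 2 ^ b * m" for m
    proof -
      have "real (4 * card V) / 2 ^ b \<le> real m \<longleftrightarrow> real (4 * card V) \<le> real (2 ^ b * m)"
        by (simp add: field_simps)
      then show ?thesis by (simp only: of_nat_le_iff)
    qed
    then show ?thesis by (simp add: u)
  qed
  finally show ?thesis .
qed

lemma prob_none_sampled:
  assumes "finite V" "B \<subseteq> V"
  shows "measure_pmf.prob (node_coins V b) {f. \<forall>v\<in>B. \<not> sampled f b v} = (1 - 1 / 2 ^ b) ^ card B"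
proof -
  let ?Y = "\<lambda>v. if v \<in> B then - {replicate b True} else UNIV"
  have "measure_pmf.prob (coin_strings b) (- {replicate b True}) = 1 - 1 / 2 ^ b"
    using measure_pmf.prob_compl[of "{replicate b True}" "coin_strings b"]
    by (simp add: Compl_eq_Diff_UNIV prob_coin_strings_singleton)
  then have "(1 - 1 / 2 ^ b) ^ card B = (\<Prod>v\<in>V. measure_pmf.prob (coin_strings b) (?Y v))"
    using assms by (simp add: if_distrib prod.If_cases Int_absorb1 cong: if_cong)
  also have "\<dots> = measure_pmf.prob (node_coins V b) (Pi V ?Y)"
    unfolding node_coins_def using assms(1) by (rule measure_Pi_pmf_Pi[symmetric])
  also have "Pi V ?Y = {f. \<forall>v\<in>B. \<not> sampled f b v}"
    using assms(2) by (force simp: sampled_def Pi_def split: if_splits)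
  finally show ?thesis by simp
qed

lemma ex_disjoint_blocks:
  assumes "D * m \<le> card N"
  obtains B where "\<And>j. j < D \<Longrightarrow> B j \<subseteq> N \<and> card (B j) = m" "disjoint_family_on B {..<D}"
proof -
  have "\<exists>B. (\<forall>j<D. B j \<subseteq> N \<and> card (B j) = m) \<and> disjoint_family_on B {..<D}"
    using assms
  proof (induction D arbitrary: N)
    case 0
    show ?case by (auto simp: disjoint_family_on_def)
  next
    case (Suc D)
    then obtain C where C: "C \<subseteq> N" "card C = m" "finite C"
      using obtain_subset_with_card_n[of m N] by (metis add_leD1 mult_Suc)
    have "D * m \<le> card (N - C)" using Suc.prems C by (simp add: card_Diff_subset)
    then obtain B where B: "\<And>j. j < D \<Longrightarrow> B j \<subseteq> N - C \<and> card (B j) = m" "disjoint_family_on B {..<D}"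
      using Suc.IH by blast
    let ?B = "\<lambda>j. if j = D then C else B j"
    have "\<forall>j<Suc D. ?B j \<subseteq> N \<and> card (?B j) = m" using B(1) C by (auto simp: less_Suc_eq)
    moreover have "disjoint_family_on ?B {..<Suc D}"
      unfolding disjoint_family_on_def
    proof (intro ballI impI)
      fix i j assume "i \<in> {..<Suc D}" "j \<in> {..<Suc D}" "i \<noteq> j"
      then consider "i = D" "j < D" | "j = D" "i < D" | "i < D" "j < D" by force
      then show "?B i \<inter> ?B j = {}"
      proof cases
        case 1 then show ?thesis using B(1)[of j] by auto
      next
        case 2 then show ?thesis using B(1)[of i] by auto
      next
        case 3 then show ?thesis using B(2) \<open>i \<noteq> j\<close> by (auto simp: disjoint_family_on_def)
      qed
    qed
    ultimately show ?case by (intro exI[of _ ?B] conjI)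
  qed
  then obtain B where "\<forall>j<D. B j \<subseteq> N \<and> card (B j) = m" "disjoint_family_on B {..<D}"
    by (elim exE conjE)
  then show ?thesis using that[of B] by simp
qed

text \<open>Disjoint blocks replace a tail estimate: if each of \<open>D\<close> disjoint blocks
  contains a sampled node, then \<open>D\<close> nodes are sampled. The bound is a union bound over
  the blocks that are missed.\<close>

lemma prob_few_sampled:
  assumes V: "finite V" and N: "N \<subseteq> V" and "D * m \<le> card N"
  shows "measure_pmf.prob (node_coins V b) {f. card {v \<in> N. sampled f b v} < D} \<le> D * (1 - 1 / 2 ^ b) ^ m"
proof -
  obtain B where B: "\<And>j. j < D \<Longrightarrow> B j \<subseteq> N \<and> card (B j) = m" and dis: "disjoint_family_on B {..<D}"
    using ex_disjoint_blocks[OF assms(3)] by metis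
  have finN: "finite N" using N V finite_subset by blast
  have "{f. card {v \<in> N. sampled f b v} < D} \<subseteq> (\<Union>j<D. {f. \<forall>v\<in>B j. \<not> sampled f b v})"
  proof (rule subsetI, rule ccontr)
    fix f assume f: "f \<in> {f. card {v \<in> N. sampled f b v} < D}"
      and n: "f \<notin> (\<Union>j<D. {f. \<forall>v\<in>B j. \<not> sampled f b v})"
    from n have "\<forall>j\<in>{..<D}. \<exists>v. v \<in> B j \<and> sampled f b v" by auto
    then obtain h where h: "\<And>j. j < D \<Longrightarrow> h j \<in> B j \<and> sampled f b (h j)"
      by (metis lessThan_iff)
    have "inj_on h {..<D}"
    proof (rule inj_onI, rule ccontr)
      fix i j assume ij: "i \<in> {..<D}" "j \<in> {..<D}" "h i = h j" "i \<noteq> j"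
      then have "B i \<inter> B j = {}" using dis by (simp add: disjoint_family_on_def)
      moreover have "h i \<in> B i" "h i \<in> B j" using h[of i] h[of j] ij by auto
      ultimately show False by blast
    qed
    moreover have "h ` {..<D} \<subseteq> {v \<in> N. sampled f b v}" using h B by auto
    ultimately have "D \<le> card {v \<in> N. sampled f b v}"
      using card_inj_on_le[of h "{..<D}" "{v \<in> N. sampled f b v}"] finN by simp
    with f show False by simp
  qed
  then have "measure_pmf.prob (node_coins V b) {f. card {v \<in> N. sampled f b v} < D} \<le>
      measure_pmf.prob (node_coins V b) (\<Union>j<D. {f. \<forall>v\<in>B j. \<not> sampled f b v})"
    by (intro measure_pmf.finite_measure_mono) auto
  also have "\<dots> \<le> (\<Sum>j<D. measure_pmf.prob (node_coins V b) {f. \<forall>v\<in>B j. \<not> sampled f b v})"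
    by (intro measure_pmf.finite_measure_subadditive_finite) auto
  also have "\<dots> = (\<Sum>j<D. (1 - 1 / 2 ^ b) ^ m)"
  proof (intro sum.cong refl)
    fix j assume "j \<in> {..<D}"
    then have "B j \<subseteq> V" "card (B j) = m" using B[of j] N by auto
    then show "measure_pmf.prob (node_coins V b) {f. \<forall>v\<in>B j. \<not> sampled f b v} = (1 - 1 / 2 ^ b) ^ m"
      using prob_none_sampled[OF V, of "B j" b] by simp
  qed
  finally show ?thesis by simp
qed

lemma one_minus_inverse_power_le_half:
  fixes N :: nat
  assumes "0 < N"
  shows "(1 - 1 / real N) ^ N \<le> 1 / 2"
proof -
  have "1 - 1 / real N \<le> exp (- (1 / real N))" using exp_ge_add_one_self[of "- (1 / real N)"] by simp
  then have "(1 - 1 / real N) ^ N \<le> exp (- (1 / real N)) ^ N"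
    using assms by (intro power_mono) auto
  also have "\<dots> = exp (- 1)" using assms by (simp add: exp_of_nat_mult[symmetric])
  also have "\<dots> \<le> 1 / 2" using exp_ge_add_one_self[of 1] by (simp add: exp_minus field_simps)
  finally show ?thesis .
qed

text \<open>A block of \<open>2 * k * 2 ^ b\<close> nodes is missed with probability at most
  \<open>2^(-2k)\<close>. For \<open>k^2\<close> blocks this adds up to
  \<open>(k / 2^k)^2 <= 1/4\<close>, which explains the factor \<open>2 * k\<close>. An oversized
  sample costs the other \<open>1/4\<close>.\<close>

lemma prob_good_sample:
  assumes V: "finite V" and N: "N \<subseteq> V" and k: "1 \<le> k" and N_card: "k\<^sup>2 * (2 * k * 2 ^ b) \<le> card N"
  shows "1 / 2 \<le> measure_pmf.prob (node_coins V b)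
    {f. 2 ^ b * card {v \<in> V. sampled f b v} \<le> 4 * card V \<and> k\<^sup>2 \<le> card {v \<in> N. sampled f b v}}"
    (is "_ \<le> measure_pmf.prob ?M ?G")
proof -
  let ?A = "{f. 4 * card V \<le> 2 ^ b * card {v \<in> V. sampled f b v}}"
  let ?B = "{f. card {v \<in> N. sampled f b v} < k\<^sup>2}"
  have "0 < k\<^sup>2 * (2 * k * 2 ^ b)" using k by simp
  then have "N \<noteq> {}" using N_card by auto
  then have "measure_pmf.prob ?M ?A \<le> 1 / 4" using N V by (intro prob_many_sampled) auto
  moreover have "measure_pmf.prob ?M ?B \<le> 1 / 4"
  proof -
    have "measure_pmf.prob ?M ?B \<le> real (k\<^sup>2) * (1 - 1 / 2 ^ b) ^ (2 * k * 2 ^ b)"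
      by (rule prob_few_sampled[OF V N N_card])
    also have "(1 - 1 / 2 ^ b :: real) ^ (2 * k * 2 ^ b) = ((1 - 1 / real (2 ^ b)) ^ 2 ^ b) ^ (2 * k)"
      by (simp add: power_mult[symmetric] mult.commute)
    also have "real (k\<^sup>2) * \<dots> \<le> real (k\<^sup>2) * (1 / 2) ^ (2 * k)"
      by (intro mult_left_mono power_mono one_minus_inverse_power_le_half) auto
    also have "\<dots> = (real k / 2 ^ k)\<^sup>2"
      by (simp add: power_divide power_mult[symmetric] mult.commute)
    also have "\<dots> \<le> (1 / 2)\<^sup>2"
    proof (rule power_mono)
      have "2 * k \<le> 2 ^ k" using k
      proof (induction k rule: dec_induct)
        case (step n)
        then show ?case by (cases n) auto
      qed simp
      then have "real (2 * k) \<le> real (2 ^ k)" by (rule of_nat_mono)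
      then show "real k / 2 ^ k \<le> 1 / 2" by (simp add: field_simps)
    qed simp
    finally show ?thesis by (simp add: power2_eq_square)
  qed
  moreover have "measure_pmf.prob ?M (?A \<union> ?B) \<le> measure_pmf.prob ?M ?A + measure_pmf.prob ?M ?B"
    by (rule measure_Un_le) auto
  moreover have "measure_pmf.prob ?M (- (?A \<union> ?B)) = 1 - measure_pmf.prob ?M (?A \<union> ?B)"
    using measure_pmf.prob_compl[of "?A \<union> ?B" ?M] by (simp add: Compl_eq_Diff_UNIV)
  moreover have "measure_pmf.prob ?M (- (?A \<union> ?B)) \<le> measure_pmf.prob ?M ?G"
    by (rule measure_pmf.finite_measure_mono) auto
  ultimately show ?thesis by simp
qed

section \<open>Relaying identifiers along colours\<close>

lemma closed_path_nth:
  "closed_path E xs \<longleftrightarrow> xs \<noteq> [] \<and> distinct xs \<and>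
     (\<forall>i. Suc i < length xs \<longrightarrow> E (xs ! i) (xs ! Suc i)) \<and> E (xs ! (length xs - 1)) (xs ! 0)"
  unfolding closed_path_def successively_conv_nth
  by (auto simp: last_conv_nth hd_conv_nth)

lemma closed_path_rotate1:
  assumes "closed_path E xs" shows "closed_path E (rotate1 xs)"
  using assms
  by (cases xs) (auto simp: closed_path_def successively_append_iff successively_Cons split: if_splits)

lemma closed_path_rotate: "closed_path E xs \<Longrightarrow> closed_path E (rotate m xs)"
  by (induction m) (simp_all add: closed_path_rotate1)

lemma closed_path_start_at:
  assumes "closed_path E xs" "v \<in> set xs"
  obtains ys where "closed_path E ys" "length ys = length xs" "set ys = set xs" "ys ! 0 = v"
proof -
  from assms(2) obtain i where i: "i < length xs" "xs ! i = v" by (auto simp: in_set_conv_nth)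
  have "xs \<noteq> []" using i by auto
  then have "rotate i xs ! 0 = v" using i by (subst nth_rotate) auto
  with closed_path_rotate[OF assms(1), of i] show ?thesis by (intro that[of "rotate i xs"]) auto
qed

lemma pcas_successively:
  assumes "pcas u p v" "set p \<subseteq> X"
  shows "successively (\<lambda>x y. (x, y) \<in> X) (u # map snd p) \<and> last (u # map snd p) = v \<and>
    pawalk_verts u p = u # map snd p"
  using assms
proof (induction p arbitrary: u)
  case (Cons e p)
  then show ?case by (cases e) auto
qed simp

lemma pcas_zip:
  assumes "successively (\<lambda>x y. (x, y) \<in> X) (u # xs)"
  shows "pcas u (zip (u # xs) xs) (last (u # xs)) \<and> set (zip (u # xs) xs) \<subseteq> X \<and>
    pawalk_verts u (zip (u # xs) xs) = u # xs"
  using assms by (induction xs arbitrary: u) auto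

lemma has_cycle_iff:
  assumes "pair_graph G"
  shows "has_cycle G l \<longleftrightarrow> (\<exists>xs. closed_path (\<lambda>u v. (u, v) \<in> parcs G) xs \<and> length xs = l)"
proof -
  interpret pair_graph G by fact
  show ?thesis
  proof
    assume "has_cycle G l"
    then obtain p u where p: "length p = l" "awalk u p u" "distinct (tl (pawalk_verts u p))" "p \<noteq> []"
      by (auto simp: has_cycle_def cycle_def)
    from p(2) have "pcas u p u" "set p \<subseteq> parcs G" by (auto simp: awalk_def)
    from pcas_successively[OF this] p show
      "\<exists>xs. closed_path (\<lambda>u v. (u, v) \<in> parcs G) xs \<and> length xs = l"
      by (intro exI[of _ "map snd p"]) (auto simp: closed_path_def successively_Cons)
  next
    assume "\<exists>xs. closed_path (\<lambda>u v. (u, v) \<in> parcs G) xs \<and> length xs = l"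
    then obtain xs where xs: "closed_path (\<lambda>u v. (u, v) \<in> parcs G) xs" "length xs = l" by blast
    \<comment> \<open>Starting the walk at the last vertex makes the list of visited vertices
      \<open>u # xs\<close>, whose tail is \<open>xs\<close>.\<close>
    define u where "u = last xs"
    have "successively (\<lambda>x y. (x, y) \<in> parcs G) (u # xs)"
      using xs by (auto simp: closed_path_def successively_Cons u_def)
    from pcas_zip[OF this] have "awalk u (zip (u # xs) xs) u"
      "distinct (tl (pawalk_verts u (zip (u # xs) xs)))"
      using xs in_arcsD1 by (auto simp: awalk_def closed_path_def u_def)
    then show "has_cycle G l"
      using xs unfolding has_cycle_def cycle_def
      by (intro exI[of _ "zip (u # xs) xs"]) (auto simp: closed_path_def)
  qed
qed

text \<open>
  Colour \<open>0\<close> is that of the sources, \<open>1, \<dots>, k - 1\<close> and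
  \<open>k, \<dots>, 2k - 2\<close> are the two sides of the cycle in the order of
  increasing distance from the source, and \<open>2k - 1\<close> is the colour of the node
  where they meet.
\<close>

definition side_color :: "nat \<Rightarrow> bool \<Rightarrow> nat \<Rightarrow> nat" where
  "side_color k \<sigma> i = (if i = 0 then 0 else if \<sigma> then k - 1 + i else i)"

definition pred_color :: "nat \<Rightarrow> nat \<Rightarrow> nat" where
  "pred_color k j = (if j = 1 \<or> j = k then 0 else j - 1)"

lemma pred_side_color: "Suc i < k \<Longrightarrow> pred_color k (side_color k \<sigma> (Suc i)) = side_color k \<sigma> i"
  by (auto simp: pred_color_def side_color_def)

lemma side_color_less: "i < k \<Longrightarrow> side_color k \<sigma> i < 2 * k - 1"
  by (auto simp: side_color_def)

lemma side_color_Suc_pos: "0 < side_color k \<sigma> (Suc i)"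
  by (simp add: side_color_def)

lemma side_color_eq_iff: "i < k \<Longrightarrow> j < k \<Longrightarrow> side_color k \<sigma> i = side_color k \<sigma> j \<longleftrightarrow> i = j"
  by (auto simp: side_color_def)

text \<open>
  The node at position \<open>i > k\<close> has distance \<open>2k - i\<close> from the source along the second side, and
  \<open>k - 1 + (2k - i) = 3k - 1 - i\<close>.
\<close>

definition cycle_color :: "nat \<Rightarrow> nat \<Rightarrow> nat" where
  "cycle_color k i = (if i < k then i else if i = k then 2 * k - 1 else 3 * k - 1 - i)"

text \<open>The search with time removed: \<open>I v\<close> is the set of messages held by
  \<open>v\<close>, subject to the equations that the rounds will be shown to enforce. A node with
  more than \<open>T\<close> messages drops out of the union, which is its silence.\<close>

locale relay =
  fixes E :: "'a \<Rightarrow> 'a \<Rightarrow> bool" and V :: "'a set" and k T :: nat and col :: "'a \<Rightarrow> nat"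
    and act src :: "'a \<Rightarrow> bool" and enc :: "'a \<Rightarrow> 'm" and I :: "'a \<Rightarrow> 'm set"
  assumes E_sym: "E u v \<Longrightarrow> E v u" and E_V: "E u v \<Longrightarrow> u \<in> V" and fin: "finite V" and k2: "2 \<le> k"
    and inj_enc: "inj_on enc V"
    and I_0: "\<And>v. v \<in> V \<Longrightarrow> col v = 0 \<Longrightarrow> I v = (if src v then {enc v} else {})"
    and I_Suc: "\<And>v. v \<in> V \<Longrightarrow> 0 < col v \<Longrightarrow> col v < 2 * k - 1 \<Longrightarrow>
      I v = \<Union>(I ` {u. E u v \<and> col u = pred_color k (col v) \<and> act u \<and> card (I u) \<le> T})"
begin

definition delivered :: "nat \<Rightarrow> 'a \<Rightarrow> 'm set" where
  "delivered j v = \<Union>(I ` {u. E u v \<and> col u = j \<and> act u \<and> card (I u) \<le> T})"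

definition layer :: "bool \<Rightarrow> nat \<Rightarrow> 'a set" where
  "layer \<sigma> i = {v \<in> V. act v \<and> col v = side_color k \<sigma> i \<and> (i = 0 \<longrightarrow> src v)}"

lemma I_side:
  assumes "v \<in> V" "col v = side_color k \<sigma> (Suc i)" "Suc i < k"
  shows "I v = delivered (side_color k \<sigma> i) v"
proof -
  have "0 < col v" "col v < 2 * k - 1"
    unfolding assms(2) using assms(3) by (simp_all only: side_color_less side_color_Suc_pos)
  then show ?thesis
    using I_Suc[OF assms(1)] assms by (simp add: delivered_def pred_side_color)
qed

text \<open>Silence can only remove messages, so this direction holds whatever the congestion. It
  yields soundness as well as the upper bounds on \<open>I\<close>.\<close>

lemma message_origin:
  assumes "m \<in> I v" "v \<in> V" "act v" "col v = side_color k \<sigma> i" "i < k"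
  shows "\<exists>w \<in> layer_origins E (layer \<sigma>) i v. m = enc w"
  using assms
proof (induction i arbitrary: v)
  case 0
  then have "col v = 0" by (simp add: side_color_def)
  with 0 I_0[of v] have "src v" "m = enc v" by (auto split: if_splits)
  with 0 show ?case by (auto simp: layer_origins_0 layer_def)
next
  case (Suc i)
  then have "m \<in> delivered (side_color k \<sigma> i) v" using I_side by blast
  then obtain u where u: "E u v" "col u = side_color k \<sigma> i" "act u" "m \<in> I u"
    by (auto simp: delivered_def)
  then obtain w where "w \<in> layer_origins E (layer \<sigma>) i u" "m = enc w"
    using Suc.IH[of u] E_V Suc.prems by auto
  moreover have "v \<in> layer \<sigma> (Suc i)" using Suc.prems by (auto simp: layer_def)
  ultimately show ?case using u(1) by (auto simp: layer_origins_Suc)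
qed

lemma layer_subset: "layer \<sigma> i \<subseteq> V"
  by (auto simp: layer_def)

lemma finite_origins: "finite (layer_origins E (layer \<sigma>) i v)"
  using layer_origins_subset[of E "layer \<sigma>"] layer_subset fin by (metis finite_subset)

lemma card_I_le:
  assumes "v \<in> V" "act v" "col v = side_color k \<sigma> i" "i < k"
  shows "card (I v) \<le> card (layer_origins E (layer \<sigma>) i v)"
proof -
  have "I v \<subseteq> enc ` layer_origins E (layer \<sigma>) i v"
    using message_origin[OF _ assms] by blast
  then have "card (I v) \<le> card (enc ` layer_origins E (layer \<sigma>) i v)"
    using finite_origins by (intro card_mono) auto
  also have "\<dots> \<le> card (layer_origins E (layer \<sigma>) i v)"
    using finite_origins by (rule card_image_le)
  finally show ?thesis .
qed

text \<open>The direction in which congestion matters. The last node only has to hold the message,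
  not to send it, hence \<open>j < i\<close> in the bound.\<close>

lemma message_relayed:
  assumes "\<And>j. j \<le> i \<Longrightarrow> p j \<in> layer \<sigma> j" "\<And>j. j < i \<Longrightarrow> E (p j) (p (Suc j))"
    and "\<And>j. j < i \<Longrightarrow> card (I (p j)) \<le> T" and "i < k"
  shows "enc (p 0) \<in> I (p i)"
  using assms
proof (induction i)
  case 0
  then have "p 0 \<in> layer \<sigma> 0" by simp
  then show ?case using I_0[of "p 0"] by (auto simp: layer_def side_color_def)
next
  case (Suc i)
  have "p (Suc i) \<in> layer \<sigma> (Suc i)" using Suc.prems(1) by blast
  then have "I (p (Suc i)) = delivered (side_color k \<sigma> i) (p (Suc i))"
    using I_side Suc.prems(4) by (auto simp: layer_def)
  moreover have "enc (p 0) \<in> I (p i)" using Suc by simp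
  moreover have "p i \<in> layer \<sigma> i" "E (p i) (p (Suc i))" "card (I (p i)) \<le> T"
    using Suc.prems by simp_all
  ultimately show ?case by (auto simp: delivered_def layer_def)
qed

definition rejects :: "'a \<Rightarrow> bool" where
  "rejects z \<longleftrightarrow> col z = 2 * k - 1 \<and> act z \<and> delivered (k - 1) z \<inter> delivered (2 * k - 2) z \<noteq> {}"

lemma side_color_last: "side_color k False (k - 1) = k - 1" "side_color k True (k - 1) = 2 * k - 2"
  using k2 by (auto simp: side_color_def)

text \<open>By injectivity of \<open>enc\<close> the two walks start at the same node. Their other
  colours are pairwise different and differ from that of \<open>z\<close>, so the colours alone show
  that no node is repeated.\<close>

lemma rejects_sound:
  assumes "rejects z"
  shows "\<exists>xs. closed_path E xs \<and> length xs = 2 * k"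
proof -
  from assms obtain m where z: "col z = 2 * k - 1" and
    m: "m \<in> delivered (side_color k False (k - 1)) z" "m \<in> delivered (side_color k True (k - 1)) z"
    unfolding side_color_last by (auto simp: rejects_def)
  have "\<exists>p. enc (p 0) = m \<and> E (p (k - 1)) z \<and> (\<forall>j\<le>k - 1. p j \<in> layer \<sigma> j) \<and>
      (\<forall>j<k - 1. E (p j) (p (Suc j)))" if "m \<in> delivered (side_color k \<sigma> (k - 1)) z" for \<sigma>
  proof -
    from that obtain u where u: "E u z" "col u = side_color k \<sigma> (k - 1)" "act u" "m \<in> I u"
      by (auto simp: delivered_def)
    then obtain w where "w \<in> layer_origins E (layer \<sigma>) (k - 1) u" "m = enc w"
      using message_origin[of m u \<sigma> "k - 1"] E_V k2 by auto
    with u(1) show ?thesis by (auto simp: layer_origins_def)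
  qed
  from this[of False] this[of True] m obtain p p' where
    p: "enc (p 0) = m" "E (p (k - 1)) z" "\<forall>j\<le>k - 1. p j \<in> layer False j"
      "\<forall>j<k - 1. E (p j) (p (Suc j))" and
    p': "enc (p' 0) = m" "E (p' (k - 1)) z" "\<forall>j\<le>k - 1. p' j \<in> layer True j"
      "\<forall>j<k - 1. E (p' j) (p' (Suc j))" by blast
  have "p 0 \<in> V" "p' 0 \<in> V" using p(3) p'(3) layer_subset by blast+
  then have eq: "p 0 = p' 0" using p(1) p'(1) inj_enc by (metis inj_onD)
  let ?xs = "map p [0..<k] @ [z] @ rev (map p' [1..<k])"
  have ne: "[0..<k] \<noteq> []" "[1..<k] \<noteq> []" using k2 by auto
  have "map (col \<circ> p) [0..<k] = map id [0..<k]"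
  proof (rule map_cong[OF refl])
    fix j assume "j \<in> set [0..<k]"
    then have "p j \<in> layer False j" using p(3) by auto
    then show "(col \<circ> p) j = id j" by (simp add: layer_def side_color_def)
  qed
  moreover have "map (col \<circ> p') [1..<k] = map (\<lambda>j. k - 1 + j) [1..<k]"
  proof (rule map_cong[OF refl])
    fix j assume "j \<in> set [1..<k]"
    then have "p' j \<in> layer True j" "0 < j" using p'(3) by auto
    then show "(col \<circ> p') j = k - 1 + j" by (simp add: layer_def side_color_def)
  qed
  ultimately have "map col ?xs = [0..<k] @ [2 * k - 1] @ rev (map (\<lambda>j. k - 1 + j) [1..<k])"
    using z by (simp add: rev_map[symmetric])
  moreover have "distinct ([0..<k] @ [2 * k - 1] @ rev (map (\<lambda>j. k - 1 + j) [1..<k]))"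
    using k2 by (auto simp: distinct_map inj_on_def)
  ultimately have "distinct ?xs" by (metis distinct_map)
  moreover have "successively E ?xs"
  proof -
    have "successively E (map p [0..<k])"
      by (rule successively_map_upt) (use p(4) in auto)
    moreover have "successively (\<lambda>x y. E y x) (map p' [1..<k])"
      by (rule successively_map_upt) (use p'(4) E_sym in auto)
    moreover have "last (map p [0..<k]) = p (k - 1)" "hd (rev (map p' [1..<k])) = p' (k - 1)"
      using k2 ne by (simp_all add: last_map hd_rev)
    ultimately show ?thesis
      using p(2) p'(2) E_sym ne
      by (simp add: successively_append_iff successively_Cons)
  qed
  moreover have "E (last ?xs) (hd ?xs)"
  proof -
    have "last ?xs = p' 1" using ne k2 by (simp add: last_rev hd_map)
    moreover have "hd ?xs = p' 0" using ne k2 eq by (simp add: hd_append hd_map)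
    moreover have "E (p' 0) (p' 1)" using p'(4) k2 by simp
    ultimately show ?thesis using E_sym by simp
  qed
  ultimately have "closed_path E ?xs" by (simp add: closed_path_def)
  moreover have "length ?xs = 2 * k" using k2 by simp
  ultimately show ?thesis by blast
qed

lemma rejects_complete:
  assumes xs: "closed_path E xs" "length xs = 2 * k"
    and col: "\<And>i. i < 2 * k \<Longrightarrow> col (xs ! i) = cycle_color k i"
    and act: "\<And>v. v \<in> set xs \<Longrightarrow> act v" and src: "src (xs ! 0)"
    and uncongested: "\<And>\<sigma> i v. v \<in> V \<Longrightarrow> act v \<Longrightarrow> col v = side_color k \<sigma> i \<Longrightarrow> i < k \<Longrightarrow> card (I v) \<le> T"
  shows "rejects (xs ! k)"
proof -
  have edge: "E (xs ! i) (xs ! Suc i)" if "Suc i < 2 * k" for i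
    using xs that by (auto simp: closed_path_nth)
  have close: "E (xs ! (2 * k - 1)) (xs ! 0)" using xs by (auto simp: closed_path_nth)
  have act': "act (xs ! i)" if "i < 2 * k" for i using act xs(2) that by auto
  have inV: "xs ! i \<in> V" if "i < 2 * k" for i
  proof (cases "i = 2 * k - 1")
    case True
    then show ?thesis using E_V[OF close] by simp
  next
    case False
    then show ?thesis using E_V[OF edge[of i]] that by simp
  qed
  \<comment> \<open>Both routes leave \<open>xs ! 0\<close> and arrive at \<open>xs ! k\<close> for
    \<open>j = k\<close>: one with increasing index, the other backwards from
    \<open>2 * k - 1\<close>.\<close>
  define p where "p \<sigma> j = (if \<sigma> \<and> j \<noteq> 0 then xs ! (2 * k - j) else xs ! j)" for \<sigma> j
  have layer: "p \<sigma> j \<in> layer \<sigma> j" if "j < k" for \<sigma> j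
  proof (cases "\<sigma> \<and> j \<noteq> 0")
    case True
    then have "2 * k - j < 2 * k" "\<not> 2 * k - j < k" "2 * k - j \<noteq> k" "3 * k - 1 - (2 * k - j) = k - 1 + j"
      using that by auto
    with True that show ?thesis
      using col[of "2 * k - j"] act'[of "2 * k - j"] inV[of "2 * k - j"]
      by (simp add: p_def layer_def side_color_def cycle_color_def)
  next
    case False
    with that show ?thesis
      using col[of j] act'[of j] inV[of j] src
      by (auto simp: p_def layer_def side_color_def cycle_color_def)
  qed
  have path: "E (p \<sigma> j) (p \<sigma> (Suc j))" if "Suc j \<le> k" for \<sigma> j
  proof (cases \<sigma>)
    case True
    have s: "2 * k - j = Suc (2 * k - Suc j)" using that by simp
    show ?thesis
    proof (cases "j = 0")
      case True
      then show ?thesis using close E_sym \<open>\<sigma>\<close> by (simp add: p_def)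
    next
      case False
      then have "E (xs ! (2 * k - Suc j)) (xs ! (2 * k - j))"
        unfolding s by (intro edge) (use that in simp)
      then show ?thesis using False \<open>\<sigma>\<close> E_sym by (simp add: p_def)
    qed
  next
    case False
    then show ?thesis using edge[of j] that k2 by (simp add: p_def)
  qed
  have "enc (xs ! 0) \<in> delivered (side_color k \<sigma> (k - 1)) (xs ! k)" for \<sigma>
  proof -
    have "enc (p \<sigma> 0) \<in> I (p \<sigma> (k - 1))"
    proof (rule message_relayed[where \<sigma> = \<sigma>])
      fix j assume j: "j < k - 1"
      then have "p \<sigma> j \<in> layer \<sigma> j" using layer by simp
      then show "card (I (p \<sigma> j)) \<le> T" using uncongested[of "p \<sigma> j" \<sigma> j] j by (auto simp: layer_def)
    qed (use layer path k2 in auto)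
    moreover have "p \<sigma> 0 = xs ! 0" by (simp add: p_def)
    moreover have "p \<sigma> k = xs ! k" by (simp add: p_def)
    then have "E (p \<sigma> (k - 1)) (xs ! k)"
      using path[of "k - 1" \<sigma>] k2 by simp
    moreover have "p \<sigma> (k - 1) \<in> layer \<sigma> (k - 1)" using layer k2 by simp
    moreover then have "card (I (p \<sigma> (k - 1))) \<le> T"
      using uncongested[of "p \<sigma> (k - 1)" \<sigma> "k - 1"] k2 by (auto simp: layer_def)
    ultimately show ?thesis by (auto simp: delivered_def layer_def)
  qed
  from this[of False] this[of True] show ?thesis
    unfolding rejects_def side_color_last
    using col[of k] act'[of k] k2 by (auto simp: cycle_color_def)
qed

lemma origins_light:
  assumes "\<And>v. v \<in> V \<Longrightarrow> act v \<Longrightarrow> card {u. E u v} \<le> \<theta>" "1 \<le> \<theta>" "i < k"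
  shows "card (layer_origins E (layer \<sigma>) i v) \<le> \<theta> ^ i"
  using assms(3)
proof (induction i arbitrary: v)
  case 0
  have "card (layer_origins E (layer \<sigma>) 0 v) \<le> card {v}"
    by (rule card_mono) (auto simp: layer_origins_0)
  then show ?case by simp
next
  case (Suc i)
  show ?case
  proof (cases "v \<in> layer \<sigma> (Suc i)")
    case True
    then have deg: "card {u. E u v} \<le> \<theta>" using assms(1) by (auto simp: layer_def)
    have "finite {u. E u v}" using E_V fin by (auto elim: finite_subset[rotated])
    then have "card (layer_origins E (layer \<sigma>) (Suc i) v) \<le>
        (\<Sum>u\<in>{u. E u v}. card (layer_origins E (layer \<sigma>) i u))"
      using True by (simp add: layer_origins_Suc card_UN_le)
    also have "\<dots> \<le> (\<Sum>u\<in>{u. E u v}. \<theta> ^ i)" using Suc by (intro sum_mono) simp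
    also have "\<dots> \<le> \<theta> ^ Suc i" using deg by simp
    finally show ?thesis .
  qed (simp add: layer_origins_Suc)
qed

lemma origins_sources:
  assumes "\<And>v. v \<in> V \<Longrightarrow> src v \<Longrightarrow> v \<in> S" "finite S"
  shows "card (layer_origins E (layer \<sigma>) i v) \<le> card S"
proof -
  have "layer_origins E (layer \<sigma>) i v \<subseteq> S"
    using layer_origins_subset[of E "layer \<sigma>" i v] assms(1) by (auto simp: layer_def)
  then show ?thesis using assms(2) by (rule card_mono[rotated])
qed

lemma origins_sampled:
  assumes S: "S \<subseteq> V" "\<And>v. v \<in> V \<Longrightarrow> act v \<Longrightarrow> v \<notin> S"
    and rich: "\<And>v. v \<in> V \<Longrightarrow> src v \<Longrightarrow> k\<^sup>2 \<le> card {s \<in> S. E s v}"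
    and nocyc: "\<And>xs. closed_path E xs \<Longrightarrow> length xs = 2 * k \<Longrightarrow> set xs \<inter> S = {}"
    and "i < k"
  shows "card (layer_origins E (layer \<sigma>) i v) \<le> k\<^sup>2 * card S"
proof (rule layer_origins_sparse)
  show "finite S" using S fin finite_subset by blast
  show "finite (layer \<sigma> 0)" using layer_subset fin finite_subset by blast
  show "layer \<sigma> i \<inter> layer \<sigma> j = {}" if "i \<noteq> j" "i < k" "j < k" for i j
    using side_color_eq_iff[of i k j \<sigma>] that by (auto simp: layer_def)
  show "layer \<sigma> i \<inter> S = {}" for i using S by (auto simp: layer_def)
  show "k\<^sup>2 \<le> card {s \<in> S. E s w}" if "w \<in> layer \<sigma> 0" for w
    using rich that by (auto simp: layer_def)
qed (use E_sym nocyc \<open>i < k\<close> in auto)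

end

section \<open>The algorithm and its execution\<close>

text \<open>Fair coins give dyadic rates; with this rounding the rate \<open>2^(-b)\<close> is
  within a factor \<open>2\<close> of \<open>n^(-1/k)\<close>.\<close>

definition sample_bits :: "nat \<Rightarrow> nat \<Rightarrow> nat" where
  "sample_bits k n = nat \<lfloor>log 2 (real n) / real k\<rfloor>"

text \<open>The size that \<open>prob_good_sample\<close> demands of a neighbourhood:
  \<open>k^2\<close> blocks of \<open>2 * k * 2 ^ b\<close> nodes.\<close>

definition light_bound :: "nat \<Rightarrow> nat \<Rightarrow> nat" where
  "light_bound k n = k\<^sup>2 * (2 * k * 2 ^ sample_bits k n)"

text \<open>The sum of the two bounds on congestion: paths of at most \<open>k - 1\<close> steps
  among light nodes, and \<open>k^2 |S|\<close> for a sample of at most four times its mean size. It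
  serves both as threshold and as slot length.\<close>

definition capacity :: "nat \<Rightarrow> nat \<Rightarrow> nat" where
  "capacity k n = light_bound k n ^ (k - 1) + k\<^sup>2 * (4 * n div 2 ^ sample_bits k n)"

text \<open>The \<open>Suc\<close> keeps codes nonempty, hence different from silence, even if the
  logarithm is \<open>0\<close>.\<close>

definition id_bits :: "nat \<Rightarrow> nat \<Rightarrow> nat" where
  "id_bits c n = Suc (c * nat \<lceil>log 2 (real n)\<rceil>)"

definition id_code :: "nat \<Rightarrow> nat \<Rightarrow> nat \<Rightarrow> bits" where
  "id_code c n x = map (bit x) [0..<id_bits c n]"

definition trial_len :: "nat \<Rightarrow> nat \<Rightarrow> nat" where
  "trial_len k n = sample_bits k n + 2 * k"

definition trial_coins :: "nat \<Rightarrow> nat \<Rightarrow> nat \<Rightarrow> bits \<Rightarrow> bits" where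
  "trial_coins k n t bs = take (trial_len k n) (drop (t * trial_len k n) bs)"

definition is_sampled :: "nat \<Rightarrow> nat \<Rightarrow> bits \<Rightarrow> bool" where
  "is_sampled k n bs \<longleftrightarrow> take (sample_bits k n) bs = replicate (sample_bits k n) True"

text \<open>Unary coding: among \<open>2k\<close> fair bits every colour below \<open>2k\<close> has
  probability at least \<open>2^(-2k)\<close>, without \<open>2k\<close> having to be a power of
  two.\<close>

definition color_of :: "nat \<Rightarrow> nat \<Rightarrow> bits \<Rightarrow> nat" where
  "color_of k n bs = length (takeWhile id (drop (sample_bits k n) bs))"

definition active :: "nat \<Rightarrow> nat \<Rightarrow> nat \<Rightarrow> nat \<Rightarrow> bool \<Rightarrow> bool" where
  "active k n phase deg smp \<longleftrightarrow>
     (if phase = 0 then deg < light_bound k n else if phase = 1 then True else \<not> smp)"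

definition is_source :: "nat \<Rightarrow> nat \<Rightarrow> nat \<Rightarrow> bool \<Rightarrow> bool" where
  "is_source k phase smp_nbrs smp \<longleftrightarrow>
     (if phase = 0 then True else if phase = 1 then smp else k\<^sup>2 \<le> smp_nbrs)"

text \<open>
  Trial \<open>t\<close> runs in the jobs \<open>3t\<close> (among light nodes), \<open>3t +
  1\<close> (from sampled nodes) and \<open>3t + 2\<close> (outside the sample). A job has
  \<open>2k\<close> slots of \<open>capacity\<close> rounds: the sampled nodes announce
  themselves in slot \<open>0\<close>, and the nodes of colour \<open>j\<close> send in slot
  \<open>j + 1\<close>.
\<close>

definition slot_time :: "nat \<Rightarrow> nat \<Rightarrow> nat \<Rightarrow> nat \<Rightarrow> nat" where
  "slot_time k n q s = (q * (2 * k) + s) * capacity k n"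

definition announced :: "nat \<Rightarrow> local_view \<Rightarrow> nat \<Rightarrow> nat set" where
  "announced k w q = {u \<in> nbr_ids w. (received w ! slot_time k (net_size w) q 0) u \<noteq> []}"

definition heard :: "nat \<Rightarrow> local_view \<Rightarrow> nat \<Rightarrow> nat \<Rightarrow> bits set" where
  "heard k w q j = {m. m \<noteq> [] \<and> (\<exists>i<capacity k (net_size w). \<exists>u\<in>nbr_ids w.
     (received w ! (slot_time k (net_size w) q (Suc j) + i)) u = m)}"

definition view_coins :: "nat \<Rightarrow> local_view \<Rightarrow> nat \<Rightarrow> bits" where
  "view_coins k w q = trial_coins k (net_size w) (q div 3) (coins w)"

definition view_active :: "nat \<Rightarrow> local_view \<Rightarrow> nat \<Rightarrow> bool" where
  "view_active k w q \<longleftrightarrow> active k (net_size w) (q mod 3) (card (nbr_ids w))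
     (is_sampled k (net_size w) (view_coins k w q))"

definition stored :: "nat \<Rightarrow> nat \<Rightarrow> local_view \<Rightarrow> nat \<Rightarrow> bits set" where
  "stored k c w q =
     (let j = color_of k (net_size w) (view_coins k w q) in
      if j = 0 then
        if is_source k (q mod 3) (card (announced k w q)) (is_sampled k (net_size w) (view_coins k w q))
        then {id_code c (net_size w) (own_id w)} else {}
      else heard k w q (pred_color k j))"

text \<open>The list depends on the set alone. A node therefore recomputes the same order in each
  round of its slot.\<close>

definition enumerate_set :: "'a set \<Rightarrow> 'a list" where
  "enumerate_set X = (SOME xs. set xs = X \<and> distinct xs)"

definition slot_message :: "nat \<Rightarrow> nat \<Rightarrow> local_view \<Rightarrow> nat \<Rightarrow> nat \<Rightarrow> nat \<Rightarrow> bits" where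
  "slot_message k c w q s i =
     (if s = 0 then if is_sampled k (net_size w) (view_coins k w q) then [True] else []
      else if color_of k (net_size w) (view_coins k w q) = s - 1 \<and> view_active k w q then
        let xs = enumerate_set (stored k c w q)
        in if length xs \<le> capacity k (net_size w) \<and> i < length xs then xs ! i else []
      else [])"

text \<open>The length test makes the bandwidth bound true for arbitrary views, as
  \<open>congest\<close> demands. In an actual run it suppresses nothing.\<close>

definition node_send :: "nat \<Rightarrow> nat \<Rightarrow> local_view \<Rightarrow> nat \<Rightarrow> bits" where
  "node_send k c w u =
     (let T = capacity k (net_size w); g = length (received w) div T;
          m = slot_message k c w (g div (2 * k)) (g mod (2 * k)) (length (received w) mod T)
      in if length m \<le> id_bits c (net_size w) then m else [])"

definition node_rejects :: "nat \<Rightarrow> nat \<Rightarrow> local_view \<Rightarrow> bool" where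
  "node_rejects k q w \<longleftrightarrow> color_of k (net_size w) (view_coins k w q) = 2 * k - 1 \<and>
     view_active k w q \<and> heard k w q (k - 1) \<inter> heard k w q (2 * k - 2) \<noteq> {}"

definition cycle_algorithm :: "nat \<Rightarrow> nat \<Rightarrow> nat \<Rightarrow> algorithm" where
  "cycle_algorithm k c R =
     \<lparr>rounds = \<lambda>n. slot_time k n (3 * R) 0,
      bandwidth = id_bits c,
      num_coins = \<lambda>n. R * trial_len k n,
      send = node_send k c,
      accept = \<lambda>w. \<not> (\<exists>q<3 * R. node_rejects k q w)\<rparr>"

lemma capacity_pos: "0 < k \<Longrightarrow> 0 < capacity k n"
  by (simp add: capacity_def light_bound_def)

lemma length_node_send: "length (node_send k c w u) \<le> id_bits c (net_size w)"
  by (simp add: node_send_def Let_def)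

lemma enumerate_set:
  assumes "finite X"
  shows "set (enumerate_set X) = X \<and> distinct (enumerate_set X)"
  unfolding enumerate_set_def using finite_distinct_list[OF assms] by (rule someI_ex)

lemma length_id_code: "length (id_code c n x) = id_bits c n"
  by (simp add: id_code_def)

lemma power_le_id_bits:
  assumes "0 < n"
  shows "n ^ c \<le> 2 ^ id_bits c n"
proof -
  let ?g = "nat \<lceil>log 2 (real n)\<rceil>"
  have "log 2 (real n) \<le> real ?g" by linarith
  then have "2 powr log 2 (real n) \<le> 2 powr real ?g" by (intro powr_mono) auto
  then have "real n \<le> 2 powr real ?g" using assms by simp
  also have "2 powr real ?g = real (2 ^ ?g)" by (subst powr_realpow) auto
  finally have "n \<le> 2 ^ ?g" by (simp only: of_nat_le_iff)
  then have "n ^ c \<le> (2 ^ ?g) ^ c" by (rule power_mono) simp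
  also have "\<dots> \<le> 2 ^ id_bits c n"
    by (simp add: id_bits_def power_mult[symmetric] mult.commute)
  finally show ?thesis .
qed

lemma inj_on_id_code:
  assumes "0 < n"
  shows "inj_on (id_code c n) {..<n ^ c}"
proof (rule inj_onI)
  fix x y assume xy: "x \<in> {..<n ^ c}" "y \<in> {..<n ^ c}" "id_code c n x = id_code c n y"
  then have "take_bit (id_bits c n) x = take_bit (id_bits c n) y"
    by (auto simp: id_code_def bit_eq_iff bit_take_bit_iff)
  moreover have "x < 2 ^ id_bits c n" "y < 2 ^ id_bits c n"
    using xy power_le_id_bits[OF assms, of c] by auto
  ultimately show "x = y" by (simp add: take_bit_nat_eq_self_iff[THEN iffD2])
qed

section \<open>An actual run as a solution of the relay equations\<close>

locale execution =
  fixes k c R :: nat and G :: "nat pair_pre_digraph" and r :: "nat \<Rightarrow> bits"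
  assumes net: "network c G" and k2: "2 \<le> k"
begin

abbreviation "n \<equiv> card (pverts G)"
abbreviation "T \<equiv> capacity k n"
abbreviation "view \<equiv> view_after (cycle_algorithm k c R) G r"

definition "smp q v \<longleftrightarrow> is_sampled k n (trial_coins k n (q div 3) (r v))"
definition "col q v = color_of k n (trial_coins k n (q div 3) (r v))"
definition "act q v \<longleftrightarrow> active k n (q mod 3) (card (nbrs G v)) (smp q v)"
definition "src q v \<longleftrightarrow> is_source k (q mod 3) (card {u \<in> nbrs G v. smp q u}) (smp q v)"

definition "transmitted q j v = {m. m \<noteq> [] \<and> (\<exists>i<T. \<exists>u\<in>nbrs G v.
  node_send k c (view (slot_time k n q (Suc j) + i) u) v = m)}"

text \<open>No time occurs here: once the slot before that of its own colour is over, a node holds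
  exactly this set, and later rounds do not change it.\<close>

definition "inbox q v = (if col q v = 0 then if src q v then {id_code c n v} else {}
  else transmitted q (pred_color k (col q v)) v)"

lemma T_pos: "0 < T"
  using k2 by (intro capacity_pos) simp

lemma view_simps [simp]:
  "net_size (view t v) = n" "own_id (view t v) = v" "nbr_ids (view t v) = nbrs G v"
  "coins (view t v) = r v"
  by (cases t; simp add: view_of_def)+

lemma send_cycle_algorithm: "send (cycle_algorithm k c R) = node_send k c"
  by (simp add: cycle_algorithm_def)

lemma received_view:
  "received (view t v) =
     map (\<lambda>i u. if u \<in> nbrs G v then node_send k c (view i u) v else []) [0..<t]"
  by (induction t) (simp_all add: view_of_def send_cycle_algorithm cong: if_cong)

lemma length_received [simp]: "length (received (view t v)) = t"
  by (simp add: received_view)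

lemma view_coins_view [simp]: "view_coins k (view t v) q = trial_coins k n (q div 3) (r v)"
  by (simp add: view_coins_def)

lemma view_active_view [simp]: "view_active k (view t v) q = act q v"
  by (simp add: view_active_def act_def smp_def)

lemma node_send_slot:
  assumes "s < 2 * k" "i < T"
  shows "node_send k c (view (slot_time k n q s + i) v) u =
    (let m = slot_message k c (view (slot_time k n q s + i) v) q s i
     in if length m \<le> id_bits c n then m else [])"
proof -
  have "(slot_time k n q s + i) div T = q * (2 * k) + s" "(slot_time k n q s + i) mod T = i"
    using assms T_pos by (simp_all add: slot_time_def)
  moreover have "(q * (2 * k) + s) div (2 * k) = q" "(q * (2 * k) + s) mod (2 * k) = s"
    using assms by simp_all
  ultimately show ?thesis by (simp add: node_send_def)
qed

lemma slot_time_mono: "s \<le> s' \<Longrightarrow> slot_time k n q s \<le> slot_time k n q s'"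
  by (simp add: slot_time_def)

lemma slot_time_Suc: "slot_time k n q (Suc s) = slot_time k n q s + T"
  by (simp add: slot_time_def)

lemma announced_view:
  assumes "slot_time k n q 1 \<le> t"
  shows "announced k (view t v) q = {u \<in> nbrs G v. smp q u}"
proof -
  have t: "slot_time k n q 0 < t" using assms T_pos slot_time_Suc[of q 0] by simp
  have "node_send k c (view (slot_time k n q 0) u) v = (if smp q u then [True] else [])" for u
    using node_send_slot[of 0 0 q u v] k2 T_pos
    by (simp add: slot_message_def smp_def id_bits_def)
  then show ?thesis using t by (auto simp: announced_def received_view)
qed

lemma heard_view:
  assumes "slot_time k n q (Suc (Suc j)) \<le> t"
  shows "heard k (view t v) q j = transmitted q j v"
proof -
  have "slot_time k n q (Suc j) + i < t" if "i < T" for i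
    using assms that slot_time_Suc[of q "Suc j"] by simp
  then show ?thesis
    unfolding heard_def transmitted_def by (simp add: received_view cong: conj_cong)
qed

lemma stored_view:
  assumes "slot_time k n q (Suc (col q v)) \<le> t"
  shows "stored k c (view t v) q = inbox q v"
proof (cases "col q v = 0")
  case True
  then show ?thesis
    using assms announced_view[of q t v]
    by (simp add: stored_def inbox_def col_def[symmetric] src_def smp_def)
next
  case False
  \<comment> \<open>Colour \<open>j\<close> sends in slot \<open>j + 1\<close>, so its messages are
    complete when slot \<open>j + 2\<close> begins. Predecessor colours are smaller, hence this is
    no later than the node's own slot.\<close>
  then have "Suc (Suc (pred_color k (col q v))) \<le> Suc (col q v)" by (simp add: pred_color_def)
  then have "slot_time k n q (Suc (Suc (pred_color k (col q v)))) \<le> t"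
    using slot_time_mono assms le_trans by blast
  from heard_view[OF this] False show ?thesis
    by (simp add: stored_def inbox_def col_def[symmetric])
qed

lemma inbox_lengths:
  assumes "m \<in> inbox q v"
  shows "m \<noteq> [] \<and> length m \<le> id_bits c n"
proof (cases "col q v = 0")
  case True
  then show ?thesis using assms length_id_code[of c n v]
    by (auto simp: inbox_def id_bits_def split: if_splits)
next
  case False
  then obtain w u where "m \<noteq> []" "m = node_send k c w u" "net_size w = n"
    using assms by (auto simp: inbox_def transmitted_def)
  then show ?thesis using length_node_send[of k c w u] by simp
qed

lemma finite_inbox: "finite (inbox q v)"
proof (rule finite_subset)
  show "inbox q v \<subseteq> {m. set m \<subseteq> UNIV \<and> length m \<le> id_bits c n}" using inbox_lengths by auto
  show "finite {m :: bits. set m \<subseteq> UNIV \<and> length m \<le> id_bits c n}"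
    by (rule finite_lists_length_le) simp
qed

text \<open>The stored set is constant during the slot, so round \<open>i\<close> sends entry
  \<open>i\<close> of one fixed list; \<open>T\<close> rounds suffice exactly for the sets that are
  not above the threshold.\<close>

lemma node_send_inbox:
  assumes "Suc j < 2 * k" "i < T"
  shows "node_send k c (view (slot_time k n q (Suc j) + i) u) v =
    (if col q u = j \<and> act q u \<and> card (inbox q u) \<le> T \<and> i < card (inbox q u)
     then enumerate_set (inbox q u) ! i else [])"
proof (cases "col q u = j")
  case True
  let ?xs = "enumerate_set (inbox q u)"
  have "stored k c (view (slot_time k n q (Suc j) + i) u) q = inbox q u"
    using True by (intro stored_view) simp
  moreover have xs: "length ?xs = card (inbox q u)" "set ?xs = inbox q u"
    using enumerate_set[OF finite_inbox] by (metis distinct_card, blast)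
  moreover have "length (?xs ! i) \<le> id_bits c n" if "i < length ?xs"
    using inbox_lengths[of "?xs ! i" q u] that xs(2) nth_mem by blast
  ultimately show ?thesis
    using True unfolding node_send_slot[OF assms]
    by (auto simp: slot_message_def Let_def col_def[symmetric])
next
  case False
  then show ?thesis unfolding node_send_slot[OF assms]
    by (simp add: slot_message_def col_def[symmetric])
qed

lemma transmitted_inbox:
  assumes "Suc j < 2 * k"
  shows "transmitted q j v =
    \<Union>(inbox q ` {u. (u, v) \<in> parcs G \<and> col q u = j \<and> act q u \<and> card (inbox q u) \<le> T})"
    (is "_ = ?R")
proof -
  have sym: "u \<in> nbrs G v \<longleftrightarrow> (u, v) \<in> parcs G" for u
    using net pair_sym_digraph.arcs_symmetric[of G]
    by (auto simp: nbrs_def network_def pair_graph_def pair_pseudo_graph_def)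
  show ?thesis
  proof (intro subset_antisym subsetI)
    fix m assume "m \<in> transmitted q j v"
    then obtain i u where m: "m \<noteq> []" "i < T" "u \<in> nbrs G v"
      "node_send k c (view (slot_time k n q (Suc j) + i) u) v = m"
      by (auto simp: transmitted_def)
    then have u: "col q u = j" "act q u" "card (inbox q u) \<le> T" "i < card (inbox q u)"
      "m = enumerate_set (inbox q u) ! i"
      unfolding node_send_inbox[OF assms m(2)] by (auto split: if_splits)
    then have "m \<in> inbox q u"
      using enumerate_set[OF finite_inbox] by (metis distinct_card nth_mem)
    then show "m \<in> ?R" using u m(3) sym by blast
  next
    fix m assume "m \<in> ?R"
    then obtain u where u: "(u, v) \<in> parcs G" "col q u = j" "act q u" "card (inbox q u) \<le> T"
      "m \<in> inbox q u" by blast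
    then obtain i where i: "i < card (inbox q u)" "enumerate_set (inbox q u) ! i = m"
      using enumerate_set[OF finite_inbox] by (metis distinct_card in_set_conv_nth)
    then have "i < T" using u by simp
    moreover have "node_send k c (view (slot_time k n q (Suc j) + i) u) v = m"
      unfolding node_send_inbox[OF assms \<open>i < T\<close>] using u i by simp
    moreover have "m \<noteq> []" using inbox_lengths u by blast
    ultimately show "m \<in> transmitted q j v" using u sym unfolding transmitted_def by blast
  qed
qed

text \<open>Each job \<open>q\<close> is one instance, with its own colours, active nodes and
  sources; from here on no rounds have to be considered.\<close>

sublocale relay "\<lambda>u v. (u, v) \<in> parcs G" "pverts G" k T "col q" "act q" "src q" "id_code c n" "inbox q" for q
proof
  interpret pair_graph G using net by (simp add: network_def)
  show "(u, v) \<in> parcs G \<Longrightarrow> (v, u) \<in> parcs G" for u v by (rule arcs_symmetric)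
  show "(u, v) \<in> parcs G \<Longrightarrow> u \<in> pverts G" for u v by (rule in_arcsD1)
  show "finite (pverts G)" by (rule pair_finite_verts)
  show "2 \<le> k" by (rule k2)
  show "inj_on (id_code c n) (pverts G)"
  proof (cases "pverts G = {}")
    case False
    then have "0 < n" using pair_finite_verts by (simp add: card_gt_0_iff)
    then show ?thesis using inj_on_id_code[of n c] net inj_on_subset by (auto simp: network_def)
  qed simp
  show "inbox q v = (if src q v then {id_code c n v} else {})" if "col q v = 0" for v
    using that by (simp add: inbox_def)
  show "inbox q v = \<Union>(inbox q ` {u. (u, v) \<in> parcs G \<and> col q u = pred_color k (col q v) \<and> act q u \<and>
      card (inbox q u) \<le> T})" if "0 < col q v" "col q v < 2 * k - 1" for v
  proof -
    have "Suc (pred_color k (col q v)) < 2 * k" using that k2 by (auto simp: pred_color_def)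
    from transmitted_inbox[OF this] that show ?thesis by (simp add: inbox_def)
  qed
qed

lemma accepts_iff: "accepts (cycle_algorithm k c R) G r v \<longleftrightarrow> \<not> (\<exists>q<3 * R. rejects q v)"
proof -
  have "node_rejects k q (view (slot_time k n (3 * R) 0) v) \<longleftrightarrow> rejects q v" if "q < 3 * R" for q
  proof -
    have "heard k (view (slot_time k n (3 * R) 0) v) q j = delivered q j v" if "Suc j < 2 * k" for j
    proof -
      have "Suc q * (2 * k) \<le> 3 * R * (2 * k)" using \<open>q < 3 * R\<close> by (intro mult_le_mono1) simp
      then have "q * (2 * k) + Suc (Suc j) \<le> 3 * R * (2 * k)" using that by simp
      then have "slot_time k n q (Suc (Suc j)) \<le> slot_time k n (3 * R) 0"
        unfolding slot_time_def by (intro mult_le_mono1) simp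
      from heard_view[OF this] show ?thesis
        by (simp add: transmitted_inbox[OF that] delivered_def)
    qed
    from this[of "k - 1"] this[of "2 * k - 2"] show ?thesis
      using k2 by (simp add: node_rejects_def rejects_def col_def[symmetric])
  qed
  then show ?thesis by (auto simp: accepts_def cycle_algorithm_def)
qed

end

section \<open>Success probability and complexity\<close>

context execution
begin

lemma accepts_if_no_cycle:
  assumes "\<not> has_cycle G (2 * k)"
  shows "accepts (cycle_algorithm k c R) G r v"
  using assms rejects_sound net has_cycle_iff[of G "2 * k"] by (auto simp: accepts_iff network_def)

lemma finite_verts: "finite (pverts G)"
  using net by (simp add: network_def pair_graph_def pair_digraph_def pair_fin_digraph_def pair_fin_digraph_axioms_def)

lemma in_nbrs_iff: "u \<in> nbrs G v \<longleftrightarrow> (u, v) \<in> parcs G"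
  using E_sym by (auto simp: nbrs_def)

lemma light_power_le:
  assumes "i < k" shows "light_bound k n ^ i \<le> T"
proof -
  have "light_bound k n ^ i \<le> light_bound k n ^ (k - 1)"
    using assms by (intro power_increasing) (auto simp: light_bound_def)
  then show ?thesis by (simp add: capacity_def)
qed

text \<open>The three alternatives belong to the jobs \<open>3t\<close>, \<open>3t + 1\<close> and
  \<open>3t + 2\<close>. In each of them a different bound on the origins excludes congestion at
  every active node with a relaying colour, not only along the cycle.\<close>

lemma some_node_rejects:
  assumes t: "t < R" and xs: "closed_path (\<lambda>u v. (u, v) \<in> parcs G) xs" "length xs = 2 * k"
    and color: "\<And>i. i < 2 * k \<Longrightarrow> color_of k n (trial_coins k n t (r (xs ! i))) = cycle_color k i"
    and S: "S = {v \<in> pverts G. is_sampled k n (trial_coins k n t (r v))}"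
    and cases: "(\<forall>v\<in>set xs. card (nbrs G v) < light_bound k n) \<or>
      k\<^sup>2 * card S \<le> T \<and> (xs ! 0 \<in> S \<or>
        k\<^sup>2 \<le> card (nbrs G (xs ! 0) \<inter> S) \<and>
        (\<forall>ys. closed_path (\<lambda>u v. (u, v) \<in> parcs G) ys \<longrightarrow> length ys = 2 * k \<longrightarrow> set ys \<inter> S = {}))"
  shows "\<exists>v\<in>pverts G. \<not> accepts (cycle_algorithm k c R) G r v"
proof -
  have edge: "(xs ! i, xs ! Suc i) \<in> parcs G" if "Suc i < 2 * k" for i
    using xs that by (auto simp: closed_path_nth)
  have "(xs ! k, xs ! Suc k) \<in> parcs G" using edge[of k] k2 by simp
  then have z: "xs ! k \<in> pverts G" by (rule E_V)
  have "(xs ! 0, xs ! 1) \<in> parcs G" using edge[of 0] k2 by simp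
  then have x0: "xs ! 0 \<in> pverts G" by (rule E_V)
  have nbrs_E: "{u. (u, v) \<in> parcs G} = nbrs G v" for v using in_nbrs_iff by auto
  have finS: "finite S" "S \<subseteq> pverts G" using S finite_verts by auto
  have smpS: "smp q v \<longleftrightarrow> v \<in> S" if "q div 3 = t" "v \<in> pverts G" for q v
    using that by (simp add: smp_def S)
  have col: "col q (xs ! i) = cycle_color k i" if "q div 3 = t" "i < 2 * k" for q i
    using that color by (simp add: col_def)
  have reject: ?thesis if "q div 3 = t" "rejects q (xs ! k)" for q
  proof -
    have "q < 3 * R" using t that(1) by linarith
    then show ?thesis using z that accepts_iff by blast
  qed
  have sq: "card S \<le> k\<^sup>2 * card S" using k2 by simp
  from cases consider (light) "\<forall>v\<in>set xs. card (nbrs G v) < light_bound k n"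
    | (sampled) "k\<^sup>2 * card S \<le> T" "xs ! 0 \<in> S"
    | (heavy) "k\<^sup>2 * card S \<le> T" "k\<^sup>2 \<le> card (nbrs G (xs ! 0) \<inter> S)"
      "\<And>ys. closed_path (\<lambda>u v. (u, v) \<in> parcs G) ys \<Longrightarrow> length ys = 2 * k \<Longrightarrow> set ys \<inter> S = {}"
    by blast
  then show ?thesis
  proof cases
    case light
    obtain q where q: "q div 3 = t" "q mod 3 = 0" by (rule that[of "3 * t + 0"]) presburger+
    have act: "act q v \<longleftrightarrow> card (nbrs G v) < light_bound k n" for v
      by (simp add: act_def active_def q)
    have "rejects q (xs ! k)"
    proof (rule rejects_complete[OF xs])
      fix \<sigma> i v assume v: "v \<in> pverts G" "act q v" "col q v = side_color k \<sigma> i" "i < k"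
      have "card (inbox q v) \<le>
          card (layer_origins (\<lambda>u v. (u, v) \<in> parcs G) (layer q \<sigma>) i v)"
        by (rule card_I_le[OF v])
      also have "\<dots> \<le> light_bound k n ^ i"
        by (rule origins_light) (use v act nbrs_E k2 in \<open>auto simp: light_bound_def\<close>)
      also have "\<dots> \<le> T" by (rule light_power_le[OF v(4)])
      finally show "card (inbox q v) \<le> T" .
    qed (use light act col[OF q(1)] in \<open>auto simp: src_def is_source_def q\<close>)
    with q(1) show ?thesis by (rule reject)
  next
    case sampled
    obtain q where q: "q div 3 = t" "q mod 3 = 1" by (rule that[of "3 * t + 1"]) presburger+
    have "rejects q (xs ! k)"
    proof (rule rejects_complete[OF xs])
      fix \<sigma> i v assume v: "v \<in> pverts G" "act q v" "col q v = side_color k \<sigma> i" "i < k"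
      have "card (inbox q v) \<le>
          card (layer_origins (\<lambda>u v. (u, v) \<in> parcs G) (layer q \<sigma>) i v)"
        by (rule card_I_le[OF v])
      also have "\<dots> \<le> card S"
        by (rule origins_sources) (use finS smpS[OF q(1)]  q in \<open>auto simp: src_def is_source_def q\<close>)
      also have "\<dots> \<le> T" by (rule le_trans[OF sq sampled(1)])
      finally show "card (inbox q v) \<le> T" .
    next
      show "src q (xs ! 0)"
        using smpS[OF q(1) x0] sampled by (simp add: src_def is_source_def q)
    qed (use col[OF q(1)] in \<open>auto simp: act_def active_def q\<close>)
    with q(1) show ?thesis by (rule reject)
  next
    case heavy
    obtain q where q: "q div 3 = t" "q mod 3 = 2" by (rule that[of "3 * t + 2"]) presburger+
    have act: "act q v \<longleftrightarrow> v \<notin> S" if "v \<in> pverts G" for v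
      using that smpS[OF q(1)] by (simp add: act_def active_def q)
    have src: "src q v \<longleftrightarrow> k\<^sup>2 \<le> card (nbrs G v \<inter> S)" if "v \<in> pverts G" for v
    proof -
      have "{u \<in> nbrs G v. smp q u} = nbrs G v \<inter> S"
        using smpS[OF q(1)] E_V in_nbrs_iff by auto
      then show ?thesis by (simp add: src_def is_source_def q)
    qed
    have "rejects q (xs ! k)"
    proof (rule rejects_complete[OF xs])
      fix \<sigma> i v assume v: "v \<in> pverts G" "act q v" "col q v = side_color k \<sigma> i" "i < k"
      have "card (inbox q v) \<le>
          card (layer_origins (\<lambda>u v. (u, v) \<in> parcs G) (layer q \<sigma>) i v)"
        by (rule card_I_le[OF v])
      also have "\<dots> \<le> k\<^sup>2 * card S"
      proof (rule origins_sampled)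
        fix w assume w: "w \<in> pverts G" "src q w"
        have "nbrs G w \<inter> S = {s \<in> S. (s, w) \<in> parcs G}" using in_nbrs_iff by auto
        with w src show "k\<^sup>2 \<le> card {s \<in> S. (s, w) \<in> parcs G}" by simp
      qed (use finS act heavy v in auto)
      also have "\<dots> \<le> T" by (rule heavy(1))
      finally show "card (inbox q v) \<le> T" .
    next
      fix v assume "v \<in> set xs"
      \<comment> \<open>No \<open>2k\<close>-cycle meets \<open>S\<close>, in particular not this
        one, so excluding the sample removes none of its nodes.\<close>
      then have "v \<notin> S" using heavy(3)[OF xs] by blast
      moreover have "v \<in> pverts G"
      proof -
        obtain ys where "closed_path (\<lambda>u v. (u, v) \<in> parcs G) ys" "length ys = length xs" "ys ! 0 = v"
          using closed_path_start_at[OF xs(1) \<open>v \<in> set xs\<close>] by metis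
        then have "(v, ys ! Suc 0) \<in> parcs G" using xs(2) k2 by (auto simp: closed_path_nth)
        then show ?thesis by (rule E_V)
      qed
      ultimately show "act q v" using act by simp
    next
      show "src q (xs ! 0)" using src[OF x0] heavy(2) by simp
    qed (use col[OF q(1)] in auto)
    with q(1) show ?thesis by (rule reject)
  qed
qed

end

text \<open>A condition on the coins \<open>g\<close> of a single trial, so that trials are
  independent copies. The cycle is quantified inside because it depends on the sample.\<close>

definition trial_succeeds :: "nat \<Rightarrow> nat pair_pre_digraph \<Rightarrow> (nat \<Rightarrow> bits) \<Rightarrow> bool" where
  "trial_succeeds k G g \<longleftrightarrow>
    (let n = card (pverts G); S = {v \<in> pverts G. is_sampled k n (g v)};
         cyc = (\<lambda>xs. closed_path (\<lambda>u v. (u, v) \<in> parcs G) xs \<and> length xs = 2 * k) in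
     \<exists>xs. cyc xs \<and> (\<forall>i<2 * k. color_of k n (g (xs ! i)) = cycle_color k i) \<and>
       ((\<forall>v\<in>set xs. card (nbrs G v) < light_bound k n) \<or>
        k\<^sup>2 * card S \<le> capacity k n \<and> (xs ! 0 \<in> S \<or>
          k\<^sup>2 \<le> card (nbrs G (xs ! 0) \<inter> S) \<and> (\<forall>ys. cyc ys \<longrightarrow> set ys \<inter> S = {}))))"

lemma closed_path_subset:
  assumes "pair_graph G" "closed_path (\<lambda>u v. (u, v) \<in> parcs G) xs"
  shows "set xs \<subseteq> pverts G"
proof
  interpret pair_graph G by fact
  fix v assume "v \<in> set xs"
  then obtain ys where ys: "closed_path (\<lambda>u v. (u, v) \<in> parcs G) ys" "ys ! 0 = v"
    using closed_path_start_at[OF assms(2)] by metis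
  then have "(ys ! (length ys - 1), v) \<in> parcs G" by (auto simp: closed_path_nth)
  then show "v \<in> pverts G" by (rule in_arcsD2)
qed

definition color_code :: "nat \<Rightarrow> nat \<Rightarrow> bits" where
  "color_code k i = replicate (cycle_color k i) True @ replicate (2 * k - cycle_color k i) False"

lemma length_color_code: "i < 2 * k \<Longrightarrow> length (color_code k i) = 2 * k"
  by (auto simp: color_code_def cycle_color_def)

lemma color_of_code:
  assumes "length bs = sample_bits k n" "i < 2 * k"
  shows "color_of k n (bs @ color_code k i) = cycle_color k i"
proof -
  have "2 * k - cycle_color k i \<noteq> 0" using assms by (auto simp: cycle_color_def)
  then obtain m where "2 * k - cycle_color k i = Suc m" using not0_implies_Suc by blast
  then show ?thesis using assms by (simp add: color_of_def color_code_def takeWhile_append)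
qed

lemma prob_trial_succeeds:
  assumes G: "pair_graph G" and k: "2 \<le> k" and "has_cycle G (2 * k)"
  shows "1 / 2 * (1 / 2 ^ (2 * k)) ^ (2 * k) \<le>
    measure_pmf.prob (node_coins (pverts G) (trial_len k (card (pverts G)))) {g. trial_succeeds k G g}"
proof -
  let ?V = "pverts G" and ?E = "\<lambda>u v. (u, v) \<in> parcs G"
  let ?n = "card ?V"
  let ?b = "sample_bits k ?n"
  let ?p = "(1 / 2 ^ (2 * k)) ^ (2 * k) :: real"
  interpret pair_graph G by fact
  have V: "finite ?V" by (rule pair_finite_verts)
  obtain xs where xs: "closed_path ?E xs" "length xs = 2 * k"
    using assms has_cycle_iff by blast
  \<comment> \<open>Stated for a fixed sample \<open>f\<close> and an arbitrary cycle
    \<open>ys\<close>, to be applied once \<open>f\<close> has determined which cycle to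
    colour.\<close>
  have color: "?p \<le> measure_pmf.prob (node_coins ?V (2 * k)) {h. hit h}"
    if f: "f \<in> set_pmf (node_coins ?V ?b)" and ys: "closed_path ?E ys" "length ys = 2 * k"
      and hit: "\<And>h. (\<And>i. i < 2 * k \<Longrightarrow> color_of k ?n (f (ys ! i) @ h (ys ! i)) = cycle_color k i) \<Longrightarrow> hit h"
    for f ys hit
  proof -
    have "?p \<le> measure_pmf.prob (node_coins ?V (2 * k)) {h. \<forall>i<length ys. h (ys ! i) = color_code k i}"
      unfolding ys(2)[symmetric]
      using prob_prescribed_coins[of ?V ys "color_code k" "2 * k"] V closed_path_subset[OF G ys(1)] ys
        length_color_code by (simp add: closed_path_def)
    also have "\<dots> \<le> measure_pmf.prob (node_coins ?V (2 * k)) {h. hit h}"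
    proof (intro measure_pmf.finite_measure_mono subsetI CollectI hit)
      fix h i assume h: "h \<in> {h. \<forall>i<length ys. h (ys ! i) = color_code k i}" and i: "i < 2 * k"
      have "ys ! i \<in> ?V" using closed_path_subset[OF G ys(1)] i ys(2) by auto
      then have "length (f (ys ! i)) = ?b" using length_node_coins[OF V f] by simp
      then show "color_of k ?n (f (ys ! i) @ h (ys ! i)) = cycle_color k i"
        using h i ys(2) color_of_code by simp
    qed simp
    finally show ?thesis .
  qed
  show ?thesis
  proof (cases "\<forall>v\<in>set xs. card (nbrs G v) < light_bound k ?n")
    case True
    \<comment> \<open>Every sample will do for a light cycle; the factor \<open>1/2\<close> is given
      away to have one bound in both cases.\<close>
    have "1 / 2 * ?p \<le> measure_pmf.prob (node_coins ?V ?b) UNIV * ?p" by simp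
    also have "\<dots> \<le> measure_pmf.prob (node_coins ?V (?b + 2 * k)) {g. trial_succeeds k G g}"
    proof (rule prob_trial_ge[OF V])
      fix f assume f: "f \<in> set_pmf (node_coins ?V ?b)"
      show "?p \<le> measure_pmf.prob (node_coins ?V (2 * k)) {h. trial_succeeds k G (\<lambda>v. f v @ h v)}"
      proof (rule color[OF f xs])
        fix h assume "\<And>i. i < 2 * k \<Longrightarrow> color_of k ?n (f (xs ! i) @ h (xs ! i)) = cycle_color k i"
        with True xs show "trial_succeeds k G (\<lambda>v. f v @ h v)"
          unfolding trial_succeeds_def Let_def by (intro exI[of _ xs]) simp
      qed
    qed simp
    finally show ?thesis unfolding trial_len_def .
  next
    case False
    then obtain v where v: "v \<in> set xs" "light_bound k ?n \<le> card (nbrs G v)" by auto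
    \<comment> \<open>Rotated so that the heavy node takes the position of the source.\<close>
    obtain zs where zs: "closed_path ?E zs" "length zs = 2 * k" "zs ! 0 = v"
      using closed_path_start_at[OF xs(1) v(1)] xs(2) by metis
    let ?S = "\<lambda>f. {v \<in> ?V. sampled f ?b v}"
    let ?A = "{f. 2 ^ ?b * card (?S f) \<le> 4 * ?n \<and> k\<^sup>2 \<le> card {u \<in> nbrs G v. sampled f ?b u}}"
    have NV: "nbrs G v \<subseteq> ?V" using in_arcsD2 by (auto simp: nbrs_def)
    have "1 / 2 \<le> measure_pmf.prob (node_coins ?V ?b) ?A"
      using prob_good_sample[OF V NV, of k ?b] k v(2) by (simp add: light_bound_def)
    then have "1 / 2 * ?p \<le> measure_pmf.prob (node_coins ?V ?b) ?A * ?p"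
      by (intro mult_right_mono) auto
    also have "\<dots> \<le> measure_pmf.prob (node_coins ?V (?b + 2 * k)) {g. trial_succeeds k G g}"
    proof (rule prob_trial_ge[OF V])
      fix f assume f: "f \<in> set_pmf (node_coins ?V ?b)" and A: "f \<in> ?A"
      have S: "{v \<in> ?V. is_sampled k ?n (f v @ h v)} = ?S f" for h
        using length_node_coins[OF V f] by (auto simp: is_sampled_def sampled_def)
      have "card (?S f) * 2 ^ ?b \<le> 4 * ?n" using A by (simp add: mult.commute)
      then have "card (?S f) \<le> 4 * ?n div 2 ^ ?b" by (simp add: less_eq_div_iff_mult_less_eq)
      then have cap: "k\<^sup>2 * card (?S f) \<le> capacity k ?n" by (simp add: capacity_def trans_le_add2)
      have rich: "k\<^sup>2 \<le> card (nbrs G (zs ! 0) \<inter> ?S f)"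
      proof -
        have "nbrs G v \<inter> ?S f = {u \<in> nbrs G v. sampled f ?b u}" using NV by auto
        then show ?thesis using A zs(3) by simp
      qed
      show "?p \<le> measure_pmf.prob (node_coins ?V (2 * k)) {h. trial_succeeds k G (\<lambda>v. f v @ h v)}"
      \<comment> \<open>If some cycle meets the sample, that one is coloured, with a sampled node as
        source; otherwise the cycle that starts at the heavy node.\<close>
      proof (cases "\<exists>ys. closed_path ?E ys \<and> length ys = 2 * k \<and> set ys \<inter> ?S f \<noteq> {}")
        case True
        then obtain ys0 s where ys0: "closed_path ?E ys0" "length ys0 = 2 * k" "s \<in> set ys0" "s \<in> ?S f"
          by blast
        obtain ys where ys: "closed_path ?E ys" "length ys = 2 * k" "ys ! 0 = s"
          using closed_path_start_at[OF ys0(1,3)] ys0(2) by metis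
        show ?thesis
        proof (rule color[OF f ys(1,2)])
          fix h assume "\<And>i. i < 2 * k \<Longrightarrow> color_of k ?n (f (ys ! i) @ h (ys ! i)) = cycle_color k i"
          with ys ys0(4) cap show "trial_succeeds k G (\<lambda>v. f v @ h v)"
            unfolding trial_succeeds_def Let_def S by (intro exI[of _ ys]) simp
        qed
      next
        case False
        show ?thesis
        proof (rule color[OF f zs(1,2)])
          fix h assume "\<And>i. i < 2 * k \<Longrightarrow> color_of k ?n (f (zs ! i) @ h (zs ! i)) = cycle_color k i"
          with zs(1,2) cap rich False show "trial_succeeds k G (\<lambda>v. f v @ h v)"
            unfolding trial_succeeds_def Let_def S by (intro exI[of _ zs] conjI disjI2) auto
        qed
      qed
    qed simp
    finally show ?thesis unfolding trial_len_def .
  qed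
qed

lemma cycle_algorithm_detects:
  assumes k: "2 \<le> k" and R: "(1 - 1 / 2 * (1 / 2 ^ (2 * k)) ^ (2 * k) :: real) ^ R \<le> 1 / 3"
  shows "detects_cycle c (2 / 3) (2 * k) (cycle_algorithm k c R)"
  unfolding detects_cycle_def
proof (intro allI impI conjI ballI)
  fix G r v assume "network c G" "\<not> has_cycle G (2 * k)"
  then interpret execution k c R G r using k by unfold_locales
  show "accepts (cycle_algorithm k c R) G r v" by (rule accepts_if_no_cycle) fact
next
  fix G assume net: "network c G" and cyc: "has_cycle G (2 * k)"
  let ?A = "cycle_algorithm k c R" and ?V = "pverts G"
  let ?l = "trial_len k (card ?V)"
  let ?q = "1 / 2 * (1 / 2 ^ (2 * k)) ^ (2 * k) :: real"
  let ?F = "{r. \<forall>t<R. \<not> trial_succeeds k G (\<lambda>v. take ?l (drop (t * ?l) (r v)))}"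
  have G: "pair_graph G" using net by (simp add: network_def)
  interpret pair_graph G by fact
  have coins: "coin_pmf ?A G = node_coins ?V (R * ?l)"
    by (simp add: coin_pmf_def node_coins_def coin_strings_def cycle_algorithm_def)
  have "(1 / 2 ^ (2 * k)) ^ (2 * k) \<le> (1 :: real)" by (intro power_le_one) auto
  then have "?q \<le> 1" by linarith
  then have "measure_pmf.prob (node_coins ?V (R * ?l)) ?F \<le> (1 - ?q) ^ R"
    using prob_trial_succeeds[OF G k cyc] by (intro prob_all_trials_fail pair_finite_verts) auto
  with R have "measure_pmf.prob (node_coins ?V (R * ?l)) ?F \<le> 1 / 3" by linarith
  moreover have "measure_pmf.prob (node_coins ?V (R * ?l)) (- ?F) =
      1 - measure_pmf.prob (node_coins ?V (R * ?l)) ?F"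
    using measure_pmf.prob_compl[of ?F "node_coins ?V (R * ?l)"] by (simp add: Compl_eq_Diff_UNIV)
  moreover have "- ?F \<subseteq> {r. \<exists>v\<in>?V. \<not> accepts ?A G r v}"
  proof
    fix r assume "r \<in> - ?F"
    then obtain t where t: "t < R" "trial_succeeds k G (\<lambda>v. trial_coins k (card ?V) t (r v))"
      by (auto simp: trial_coins_def)
    interpret execution k c R G r using net k by unfold_locales
    from t(2) obtain xs where "closed_path (\<lambda>u v. (u, v) \<in> parcs G) xs" "length xs = 2 * k"
      "\<And>i. i < 2 * k \<Longrightarrow> color_of k (card ?V) (trial_coins k (card ?V) t (r (xs ! i))) = cycle_color k i"
      "(\<forall>v\<in>set xs. card (nbrs G v) < light_bound k (card ?V)) \<or>
        k\<^sup>2 * card {v \<in> ?V. is_sampled k (card ?V) (trial_coins k (card ?V) t (r v))} \<le> capacity k (card ?V) \<and>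
        (xs ! 0 \<in> {v \<in> ?V. is_sampled k (card ?V) (trial_coins k (card ?V) t (r v))} \<or>
          k\<^sup>2 \<le> card (nbrs G (xs ! 0) \<inter> {v \<in> ?V. is_sampled k (card ?V) (trial_coins k (card ?V) t (r v))}) \<and>
          (\<forall>ys. closed_path (\<lambda>u v. (u, v) \<in> parcs G) ys \<longrightarrow> length ys = 2 * k \<longrightarrow>
            set ys \<inter> {v \<in> ?V. is_sampled k (card ?V) (trial_coins k (card ?V) t (r v))} = {}))"
      unfolding trial_succeeds_def Let_def by auto
    from some_node_rejects[OF t(1) this(1,2,3) refl this(4)]
    show "r \<in> {r. \<exists>v\<in>?V. \<not> accepts ?A G r v}" by simp
  qed
  then have "measure_pmf.prob (node_coins ?V (R * ?l)) (- ?F) \<le>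
      measure_pmf.prob (node_coins ?V (R * ?l)) {r. \<exists>v\<in>?V. \<not> accepts ?A G r v}"
    by (intro measure_pmf.finite_measure_mono) auto
  ultimately show "2 / 3 \<le> measure_pmf.prob (coin_pmf ?A G) {r. \<exists>v\<in>?V. \<not> accepts ?A G r v}"
    unfolding coins by linarith
qed

section \<open>Asymptotics of bandwidth and rounds\<close>

lemma id_bits_bigo: "(\<lambda>n. real (id_bits c n)) \<in> O(\<lambda>n. ln (real n))"
proof (rule bigoI)
  show "\<forall>\<^sub>F n in sequentially. norm (real (id_bits c n)) \<le> (1 + 3 * real c) * norm (ln (real n))"
    using eventually_ge_at_top[of 3]
  proof eventually_elim
    case (elim n)
    \<comment> \<open>From \<open>n = 3\<close> on \<open>ln n\<close> is at least \<open>1\<close>,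
      which absorbs the rounding up and the additional bit.\<close>
    have "exp 1 \<le> real n" using exp_le elim by linarith
    then have ln1: "1 \<le> ln (real n)" using elim by (subst ln_ge_iff) auto
    have "1 / 2 \<le> ln (2 :: real)" using ln2_ge_two_thirds by simp
    then have "ln (real n) * (1 / 2) \<le> ln (real n) * ln 2" using ln1 by (intro mult_left_mono) auto
    then have "log 2 (real n) \<le> 2 * ln (real n)" by (simp add: log_def field_simps)
    then have "real (nat \<lceil>log 2 (real n)\<rceil>) \<le> 3 * ln (real n)"
      using ln1 elim by (simp add: of_nat_nat) linarith
    then have "real c * real (nat \<lceil>log 2 (real n)\<rceil>) \<le> real c * (3 * ln (real n))"
      by (rule mult_left_mono) simp
    then have "real (id_bits c n) \<le> 1 + real c * (3 * ln (real n))" by (simp add: id_bits_def)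
    also have "\<dots> \<le> (1 + 3 * real c) * ln (real n)" using ln1 by (simp add: algebra_simps)
    finally show ?case using ln1 by simp
  qed
qed

lemma sample_bits_bounds:
  assumes "0 < n" "0 < k"
  shows "2 ^ sample_bits k n \<le> real n powr (1 / real k)"
    and "real n powr (1 / real k) \<le> 2 * 2 ^ sample_bits k n"
proof -
  let ?L = "log 2 (real n) / real k"
  have "0 \<le> log 2 (real n)" using assms by simp
  then have "0 \<le> ?L" by simp
  then have b: "real (sample_bits k n) \<le> ?L" "?L \<le> real (Suc (sample_bits k n))"
    unfolding sample_bits_def by linarith+
  have L: "2 powr ?L = real n powr (1 / real k)"
    using assms powr_powr[of 2 "log 2 (real n)" "1 / real k"] by simp
  have "2 ^ sample_bits k n = 2 powr real (sample_bits k n)" by (simp add: powr_realpow)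
  also have "\<dots> \<le> 2 powr ?L" using b by (intro powr_mono) auto
  finally show "2 ^ sample_bits k n \<le> real n powr (1 / real k)" by (simp add: L)
  have "2 powr ?L \<le> 2 powr real (Suc (sample_bits k n))" using b by (intro powr_mono) auto
  also have "\<dots> = 2 ^ Suc (sample_bits k n)" by (rule powr_realpow) simp
  finally show "real n powr (1 / real k) \<le> 2 * 2 ^ sample_bits k n" by (simp add: L)
qed

text \<open>The first summand is the power of \<open>light_bound k n <= 2 k^3 n^(1/k)\<close>. The
  \<open>8\<close> comes from \<open>4 n / 2^b\<close>, where rounding leaves \<open>2^b\<close> at
  least half of \<open>n^(1/k)\<close>.\<close>

lemma capacity_le:
  assumes n: "0 < n" and k: "0 < k"
  shows "real (capacity k n) \<le>
    ((2 * real k ^ 3) ^ (k - 1) + 8 * (real k)\<^sup>2) * real n powr (1 - 1 / real k)"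
proof -
  let ?x = "real n powr (1 / real k)" and ?y = "real n powr (1 - 1 / real k)"
  let ?b = "sample_bits k n"
  have x: "0 < ?x" using n by simp
  have "real (light_bound k n) = 2 * real k ^ 3 * 2 ^ ?b"
    by (simp add: light_bound_def power2_eq_square power3_eq_cube)
  also have "\<dots> \<le> 2 * real k ^ 3 * ?x"
    using sample_bits_bounds(1)[OF assms] by (intro mult_left_mono) auto
  finally have "real (light_bound k n) ^ (k - 1) \<le> (2 * real k ^ 3 * ?x) ^ (k - 1)"
    by (intro power_mono) auto
  also have "\<dots> = (2 * real k ^ 3) ^ (k - 1) * ?x ^ (k - 1)" by (rule power_mult_distrib)
  also have "?x ^ (k - 1) = ?y"
  proof -
    have "?x ^ (k - 1) = ?x powr real (k - 1)" using x by (simp add: powr_realpow)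
    also have "\<dots> = real n powr (1 / real k * real (k - 1))" by (rule powr_powr)
    also have "1 / real k * real (k - 1) = 1 - 1 / real k" using k by (simp add: field_simps)
    finally show ?thesis .
  qed
  finally have 1: "real (light_bound k n) ^ (k - 1) \<le> (2 * real k ^ 3) ^ (k - 1) * ?y" .
  have "real (4 * n div 2 ^ ?b) \<le> 4 * real n / 2 ^ ?b"
    using of_nat_div_le_of_nat[of "4 * n" "2 ^ ?b"] by simp
  also have "\<dots> \<le> 8 * real n / ?x"
  proof -
    have "4 * real n * ?x \<le> 4 * real n * (2 * 2 ^ ?b)"
      using sample_bits_bounds(2)[OF assms] by (intro mult_left_mono) auto
    then show ?thesis using x by (simp add: field_simps)
  qed
  also have "8 * real n / ?x = 8 * ?y" using n by (simp add: powr_diff)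
  finally have 2: "real (4 * n div 2 ^ ?b) \<le> 8 * ?y" .
  have "(real k)\<^sup>2 * real (4 * n div 2 ^ ?b) \<le> (real k)\<^sup>2 * (8 * ?y)"
    using 2 by (intro mult_left_mono) auto
  with 1 show ?thesis
    unfolding capacity_def of_nat_add of_nat_mult of_nat_power by (simp add: algebra_simps)
qed

lemma rounds_bigo:
  assumes "0 < k"
  shows "(\<lambda>n. real (slot_time k n q 0)) \<in> O(\<lambda>n. real n powr (1 - 1 / real k))"
proof (rule bigoI)
  let ?C = "(2 * real k ^ 3) ^ (k - 1) + 8 * (real k)\<^sup>2"
  show "\<forall>\<^sub>F n in sequentially. norm (real (slot_time k n q 0)) \<le>
      real (q * (2 * k)) * ?C * norm (real n powr (1 - 1 / real k))"
    using eventually_gt_at_top[of 0]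
  proof eventually_elim
    case (elim n)
    have "real (slot_time k n q 0) = real (q * (2 * k)) * real (capacity k n)"
      by (simp add: slot_time_def)
    also have "\<dots> \<le> real (q * (2 * k)) * (?C * real n powr (1 - 1 / real k))"
      by (rule mult_left_mono[OF capacity_le[OF elim assms]]) simp
    finally show ?case by (simp add: mult.assoc)
  qed
qed

theorem theorem5:
  fixes k c :: nat
  assumes "k \<in> {3, 4, 5}" and "c \<ge> 1"
  shows "\<exists>A. congest A \<and> detects_cycle c (2 / 3) (2 * k) A \<and>
    (\<lambda>n. real (rounds A n)) \<in> O(\<lambda>n. real n powr (1 - 1 / real k))"
proof -
  have k: "2 \<le> k" using assms(1) by auto
  let ?q = "1 / 2 * (1 / 2 ^ (2 * k)) ^ (2 * k) :: real"
  have "0 < ?q" by simp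
  \<comment> \<open>\<open>R\<close> depends on \<open>k\<close> alone, so repeating the trials
    costs a constant factor in the number of rounds.\<close>
  then obtain R where R: "(1 - ?q) ^ R < 1 / 3"
    using real_arch_pow_inv[of "1 / 3" "1 - ?q"] by auto
  show ?thesis
  proof (intro exI conjI)
    show "congest (cycle_algorithm k c R)"
      using length_node_send id_bits_bigo by (simp add: congest_def cycle_algorithm_def)
    show "detects_cycle c (2 / 3) (2 * k) (cycle_algorithm k c R)"
      using cycle_algorithm_detects[OF k less_imp_le[OF R]] .
    show "(\<lambda>n. real (rounds (cycle_algorithm k c R) n)) \<in> O(\<lambda>n. real n powr (1 - 1 / real k))"
      using rounds_bigo[of k "3 * R"] k by (simp add: cycle_algorithm_def)
  qed
qed

end
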